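(* Let $k$ be a field and let $\mathcal{T}$ be a symmetric compact closed category with finite direct sums such that (i) there is a finite set $\mathcal{C}$ of objects of $\mathcal{T}$ such that every object $X$ of $\mathcal{T}$ can be written as a direct sum $X\cong\bigoplus_{i=1}^n C_i$ with $C_i\in\mathcal{C}$; and (ii) each hom $\mathcal{T}(X,Y)$ is a finitely generated commutative monoid. Then the tensor product $M*N$ of finite-dimensional Mackey functors $M,N$ on $\mathcal{T}$ is finite dimensional.
   Context: Having finite direct sums, $\mathcal{T}$ is canonically enriched in commutative monoids. Write $\otimes$ for its tensor product. A Mackey functor on $\mathcal{T}$ is an additive functor $M:\mathcal{T}\to\mathbf{Vect}$ to the category of $k$-vector spaces. It is finite dimensional when each $M(X)$ is a finite-dimensional vector space. The tensor product of Mackey functors is Day convolution $$(M*N)(Z)=\int^{X,Y}\mathcal{T}(X\otimes Y,Z)\otimes M(X)\otimes_k N(Y),$$ a coend enriched in commutative monoids, where for a commutative monoid $V$ and a vector space $P$, $V\otimes P$ is the vector space with $\mathrm{Hom}_k(V\otimes P,Q)\cong\mathrm{Hom}_{\mathrm{CMon}}(V,\mathrm{Hom}_k(P,Q))$ naturally in $Q$. *)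

theory Defs
  imports "HOL-Algebra.AbelCoset" "Jordan_Normal_Form.Missing_VectorSpace"
begin

section \<open>Categories with finite direct sums\<close>

record ('o, 'm) cat =
  Obj :: "'o set"
  Arr :: "'m set"
  Dom :: "'m \<Rightarrow> 'o"
  Cod :: "'m \<Rightarrow> 'o"
  Ide :: "'o \<Rightarrow> 'm"
  Comp :: "'m \<Rightarrow> 'm \<Rightarrow> 'm"  (infixl \<open>\<cdot>\<index>\<close> 70)

definition Hom :: "('o, 'm, 'c) cat_scheme \<Rightarrow> 'o \<Rightarrow> 'o \<Rightarrow> 'm set" where
  "Hom C X Y = {f \<in> Arr C. Dom C f = X \<and> Cod C f = Y}"

locale category =
  fixes C (structure)
  assumes Dom_Obj: "f \<in> Arr C \<Longrightarrow> Dom C f \<in> Obj C"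
    and Cod_Obj: "f \<in> Arr C \<Longrightarrow> Cod C f \<in> Obj C"
    and Ide_Hom: "X \<in> Obj C \<Longrightarrow> Ide C X \<in> Hom C X X"
    and Comp_Hom: "f \<in> Hom C X Y \<Longrightarrow> g \<in> Hom C Y Z \<Longrightarrow> g \<cdot> f \<in> Hom C X Z"
    and Comp_Ide: "f \<in> Hom C X Y \<Longrightarrow> f \<cdot> Ide C X = f"
    and Ide_Comp: "f \<in> Hom C X Y \<Longrightarrow> Ide C Y \<cdot> f = f"
    and Comp_assoc: "f \<in> Hom C W X \<Longrightarrow> g \<in> Hom C X Y \<Longrightarrow> h \<in> Hom C Y Z \<Longrightarrow>
      (h \<cdot> g) \<cdot> f = h \<cdot> (g \<cdot> f)"

definition inverse_arrs :: "('o, 'm, 'c) cat_scheme \<Rightarrow> 'm \<Rightarrow> 'm \<Rightarrow> bool" where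
  "inverse_arrs C f g \<longleftrightarrow> f \<in> Hom C (Cod C g) (Dom C g) \<and> g \<in> Hom C (Cod C f) (Dom C f)
     \<and> g \<cdot>\<^bsub>C\<^esub> f = Ide C (Dom C f) \<and> f \<cdot>\<^bsub>C\<^esub> g = Ide C (Cod C f)"

definition iso_arr :: "('o, 'm, 'c) cat_scheme \<Rightarrow> 'm \<Rightarrow> bool" where
  "iso_arr C f \<longleftrightarrow> (\<exists>g. inverse_arrs C f g)"

definition inv_arr :: "('o, 'm, 'c) cat_scheme \<Rightarrow> 'm \<Rightarrow> 'm" where
  "inv_arr C f = (THE g. inverse_arrs C f g)"

definition isomorphic :: "('o, 'm, 'c) cat_scheme \<Rightarrow> 'o \<Rightarrow> 'o \<Rightarrow> bool" where
  "isomorphic C X Y \<longleftrightarrow> (\<exists>f \<in> Hom C X Y. iso_arr C f)"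

definition prod_cat :: "('o, 'm, 'c) cat_scheme \<Rightarrow> ('o2, 'm2, 'd) cat_scheme
    \<Rightarrow> ('o \<times> 'o2, 'm \<times> 'm2) cat" where
  "prod_cat C D = \<lparr>Obj = Obj C \<times> Obj D, Arr = Arr C \<times> Arr D,
     Dom = map_prod (Dom C) (Dom D), Cod = map_prod (Cod C) (Cod D),
     Ide = map_prod (Ide C) (Ide D),
     Comp = (\<lambda>(g, g') (f, f'). (g \<cdot>\<^bsub>C\<^esub> f, g' \<cdot>\<^bsub>D\<^esub> f'))\<rparr>"


subsection \<open>Direct sums\<close>

definition zero_object :: "('o, 'm, 'c) cat_scheme \<Rightarrow> 'o \<Rightarrow> bool" where
  "zero_object C Z \<longleftrightarrow> Z \<in> Obj C \<and>
     (\<forall>X \<in> Obj C. (\<exists>!f. f \<in> Hom C X Z) \<and> (\<exists>!f. f \<in> Hom C Z X))"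

definition zero_arr :: "('o, 'm, 'c) cat_scheme \<Rightarrow> 'o \<Rightarrow> 'o \<Rightarrow> 'm" where
  "zero_arr C X Y =
     (THE f. \<exists>Z g h. zero_object C Z \<and> h \<in> Hom C X Z \<and> g \<in> Hom C Z Y \<and> f = g \<cdot>\<^bsub>C\<^esub> h)"

definition is_product :: "('o, 'm, 'c) cat_scheme \<Rightarrow> 'i set \<Rightarrow> ('i \<Rightarrow> 'o) \<Rightarrow> 'o \<Rightarrow> ('i \<Rightarrow> 'm) \<Rightarrow> bool" where
  "is_product C I A S p \<longleftrightarrow> S \<in> Obj C \<and> (\<forall>i\<in>I. p i \<in> Hom C S (A i)) \<and>
     (\<forall>X \<in> Obj C. \<forall>f. (\<forall>i\<in>I. f i \<in> Hom C X (A i)) \<longrightarrow>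
        (\<exists>!h. h \<in> Hom C X S \<and> (\<forall>i\<in>I. p i \<cdot>\<^bsub>C\<^esub> h = f i)))"

definition is_coproduct :: "('o, 'm, 'c) cat_scheme \<Rightarrow> 'i set \<Rightarrow> ('i \<Rightarrow> 'o) \<Rightarrow> 'o \<Rightarrow> ('i \<Rightarrow> 'm) \<Rightarrow> bool" where
  "is_coproduct C I A S q \<longleftrightarrow> S \<in> Obj C \<and> (\<forall>i\<in>I. q i \<in> Hom C (A i) S) \<and>
     (\<forall>X \<in> Obj C. \<forall>f. (\<forall>i\<in>I. f i \<in> Hom C (A i) X) \<longrightarrow>
        (\<exists>!h. h \<in> Hom C S X \<and> (\<forall>i\<in>I. h \<cdot>\<^bsub>C\<^esub> q i = f i)))"

definition is_direct_sum :: "('o, 'm, 'c) cat_scheme \<Rightarrow> 'i set \<Rightarrow> ('i \<Rightarrow> 'o) \<Rightarrow> 'o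
    \<Rightarrow> ('i \<Rightarrow> 'm) \<Rightarrow> ('i \<Rightarrow> 'm) \<Rightarrow> bool" where
  "is_direct_sum C I A S p q \<longleftrightarrow> (\<forall>i\<in>I. A i \<in> Obj C) \<and>
     is_product C I A S p \<and> is_coproduct C I A S q \<and>
     (\<forall>i\<in>I. \<forall>j\<in>I. p j \<cdot>\<^bsub>C\<^esub> q i = (if i = j then Ide C (A i) else zero_arr C (A i) (A j)))"

text \<open>The case \<open>n = 0\<close> says that there is a zero object, so that \<^const>\<open>zero_arr\<close> is meaningful
  in the other cases.\<close>

definition has_finite_direct_sums :: "('o, 'm, 'c) cat_scheme \<Rightarrow> bool" where
  "has_finite_direct_sums C \<longleftrightarrow>
     (\<forall>(n::nat) A. (\<forall>i<n. A i \<in> Obj C) \<longrightarrow> (\<exists>S p q. is_direct_sum C {..<n} A S p q))"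

text \<open>The canonical addition: \<open>f + g\<close> is the composite of \<open>\<langle>f, g\<rangle> : X \<rightarrow> Y \<oplus> Y\<close> with the
  codiagonal \<open>Y \<oplus> Y \<rightarrow> Y\<close>; the value does not depend on the direct sum \<open>S\<close> of \<open>Y\<close> with
  itself.\<close>

definition add_arr :: "('o, 'm, 'c) cat_scheme \<Rightarrow> 'm \<Rightarrow> 'm \<Rightarrow> 'm" where
  "add_arr C f g = (THE h. \<exists>S p q u d.
     is_direct_sum C {..<2::nat} (\<lambda>_. Cod C f) S p q \<and>
     u \<in> Hom C (Dom C f) S \<and> p 0 \<cdot>\<^bsub>C\<^esub> u = f \<and> p 1 \<cdot>\<^bsub>C\<^esub> u = g \<and>
     d \<in> Hom C S (Cod C f) \<and> d \<cdot>\<^bsub>C\<^esub> q 0 = Ide C (Cod C f) \<and> d \<cdot>\<^bsub>C\<^esub> q 1 = Ide C (Cod C f) \<and>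
     h = d \<cdot>\<^bsub>C\<^esub> u)"

definition hom_monoid :: "('o, 'm, 'c) cat_scheme \<Rightarrow> 'o \<Rightarrow> 'o \<Rightarrow> 'm monoid" where
  "hom_monoid C X Y = \<lparr>carrier = Hom C X Y, mult = add_arr C, one = zero_arr C X Y\<rparr>"

definition fin_gen_comm_monoid :: "('a, 'b) monoid_scheme \<Rightarrow> bool" where
  "fin_gen_comm_monoid V \<longleftrightarrow> comm_monoid V \<and>
     (\<exists>S. finite S \<and> S \<subseteq> carrier V \<and> (\<forall>H. submonoid H V \<and> S \<subseteq> H \<longrightarrow> H = carrier V))"


section \<open>Symmetric compact closed categories\<close>

record ('o, 'm) sm_cat = "('o, 'm) cat" +
  tensor_obj :: "'o \<Rightarrow> 'o \<Rightarrow> 'o"  (infixl \<open>\<boxtimes>\<index>\<close> 75)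
  tensor_arr :: "'m \<Rightarrow> 'm \<Rightarrow> 'm"  (infixl \<open>\<boxtimes>\<^sub>a\<index>\<close> 75)
  unit_obj :: "'o"  (\<open>\<I>\<index>\<close>)
  associator :: "'o \<Rightarrow> 'o \<Rightarrow> 'o \<Rightarrow> 'm"
  left_unitor :: "'o \<Rightarrow> 'm"
  right_unitor :: "'o \<Rightarrow> 'm"
  braiding :: "'o \<Rightarrow> 'o \<Rightarrow> 'm"

locale symmetric_monoidal_category = category T for T (structure) +
  assumes tensor_Obj: "X \<in> Obj T \<Longrightarrow> Y \<in> Obj T \<Longrightarrow> X \<boxtimes> Y \<in> Obj T"
    and unit_Obj: "\<I> \<in> Obj T"
    and tensor_Hom: "f \<in> Hom T X X' \<Longrightarrow> g \<in> Hom T Y Y' \<Longrightarrow> f \<boxtimes>\<^sub>a g \<in> Hom T (X \<boxtimes> Y) (X' \<boxtimes> Y')"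
    and tensor_Ide: "X \<in> Obj T \<Longrightarrow> Y \<in> Obj T \<Longrightarrow> Ide T X \<boxtimes>\<^sub>a Ide T Y = Ide T (X \<boxtimes> Y)"
    and tensor_Comp: "f \<in> Hom T X X' \<Longrightarrow> f' \<in> Hom T X' X'' \<Longrightarrow> g \<in> Hom T Y Y' \<Longrightarrow> g' \<in> Hom T Y' Y'' \<Longrightarrow>
      (f' \<cdot> f) \<boxtimes>\<^sub>a (g' \<cdot> g) = (f' \<boxtimes>\<^sub>a g') \<cdot> (f \<boxtimes>\<^sub>a g)"
    and associator_Hom: "X \<in> Obj T \<Longrightarrow> Y \<in> Obj T \<Longrightarrow> Z \<in> Obj T \<Longrightarrow>
      associator T X Y Z \<in> Hom T ((X \<boxtimes> Y) \<boxtimes> Z) (X \<boxtimes> (Y \<boxtimes> Z))"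
    and associator_iso: "X \<in> Obj T \<Longrightarrow> Y \<in> Obj T \<Longrightarrow> Z \<in> Obj T \<Longrightarrow> iso_arr T (associator T X Y Z)"
    and associator_natural: "f \<in> Hom T X X' \<Longrightarrow> g \<in> Hom T Y Y' \<Longrightarrow> h \<in> Hom T Z Z' \<Longrightarrow>
      associator T X' Y' Z' \<cdot> ((f \<boxtimes>\<^sub>a g) \<boxtimes>\<^sub>a h) = (f \<boxtimes>\<^sub>a (g \<boxtimes>\<^sub>a h)) \<cdot> associator T X Y Z"
    and left_unitor_Hom: "X \<in> Obj T \<Longrightarrow> left_unitor T X \<in> Hom T (\<I> \<boxtimes> X) X"
    and left_unitor_iso: "X \<in> Obj T \<Longrightarrow> iso_arr T (left_unitor T X)"
    and left_unitor_natural: "f \<in> Hom T X X' \<Longrightarrow>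
      left_unitor T X' \<cdot> (Ide T \<I> \<boxtimes>\<^sub>a f) = f \<cdot> left_unitor T X"
    and right_unitor_Hom: "X \<in> Obj T \<Longrightarrow> right_unitor T X \<in> Hom T (X \<boxtimes> \<I>) X"
    and right_unitor_iso: "X \<in> Obj T \<Longrightarrow> iso_arr T (right_unitor T X)"
    and right_unitor_natural: "f \<in> Hom T X X' \<Longrightarrow>
      right_unitor T X' \<cdot> (f \<boxtimes>\<^sub>a Ide T \<I>) = f \<cdot> right_unitor T X"
    and braiding_Hom: "X \<in> Obj T \<Longrightarrow> Y \<in> Obj T \<Longrightarrow> braiding T X Y \<in> Hom T (X \<boxtimes> Y) (Y \<boxtimes> X)"
    and braiding_natural: "f \<in> Hom T X X' \<Longrightarrow> g \<in> Hom T Y Y' \<Longrightarrow>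
      braiding T X' Y' \<cdot> (f \<boxtimes>\<^sub>a g) = (g \<boxtimes>\<^sub>a f) \<cdot> braiding T X Y"
    and braiding_symmetric: "X \<in> Obj T \<Longrightarrow> Y \<in> Obj T \<Longrightarrow>
      braiding T Y X \<cdot> braiding T X Y = Ide T (X \<boxtimes> Y)"
    and pentagon: "W \<in> Obj T \<Longrightarrow> X \<in> Obj T \<Longrightarrow> Y \<in> Obj T \<Longrightarrow> Z \<in> Obj T \<Longrightarrow>
      (Ide T W \<boxtimes>\<^sub>a associator T X Y Z) \<cdot> associator T W (X \<boxtimes> Y) Z \<cdot> (associator T W X Y \<boxtimes>\<^sub>a Ide T Z)
      = associator T W X (Y \<boxtimes> Z) \<cdot> associator T (W \<boxtimes> X) Y Z"
    and triangle: "X \<in> Obj T \<Longrightarrow> Y \<in> Obj T \<Longrightarrow>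
      (Ide T X \<boxtimes>\<^sub>a left_unitor T Y) \<cdot> associator T X \<I> Y = right_unitor T X \<boxtimes>\<^sub>a Ide T Y"
    and hexagon: "X \<in> Obj T \<Longrightarrow> Y \<in> Obj T \<Longrightarrow> Z \<in> Obj T \<Longrightarrow>
      associator T Y Z X \<cdot> braiding T X (Y \<boxtimes> Z) \<cdot> associator T X Y Z
      = (Ide T Y \<boxtimes>\<^sub>a braiding T X Z) \<cdot> associator T Y X Z \<cdot> (braiding T X Y \<boxtimes>\<^sub>a Ide T Z)"

text \<open>The two equations are the triangle identities for the unit \<open>\<eta>\<close> and the counit \<open>\<epsilon>\<close>.\<close>

definition is_dual :: "('o, 'm, 'c) sm_cat_scheme \<Rightarrow> 'o \<Rightarrow> 'o \<Rightarrow> bool" where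
  "is_dual T X D \<longleftrightarrow> D \<in> Obj T \<and>
    (\<exists>\<eta> \<in> Hom T \<I>\<^bsub>T\<^esub> (D \<boxtimes>\<^bsub>T\<^esub> X). \<exists>\<epsilon> \<in> Hom T (X \<boxtimes>\<^bsub>T\<^esub> D) \<I>\<^bsub>T\<^esub>.
      left_unitor T X \<cdot>\<^bsub>T\<^esub> (\<epsilon> \<boxtimes>\<^sub>a\<^bsub>T\<^esub> Ide T X) \<cdot>\<^bsub>T\<^esub> inv_arr T (associator T X D X)
        \<cdot>\<^bsub>T\<^esub> (Ide T X \<boxtimes>\<^sub>a\<^bsub>T\<^esub> \<eta>) \<cdot>\<^bsub>T\<^esub> inv_arr T (right_unitor T X) = Ide T X \<and>
      right_unitor T D \<cdot>\<^bsub>T\<^esub> (Ide T D \<boxtimes>\<^sub>a\<^bsub>T\<^esub> \<epsilon>) \<cdot>\<^bsub>T\<^esub> associator T D X D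
        \<cdot>\<^bsub>T\<^esub> (\<eta> \<boxtimes>\<^sub>a\<^bsub>T\<^esub> Ide T D) \<cdot>\<^bsub>T\<^esub> inv_arr T (left_unitor T D) = Ide T D)"

locale symmetric_compact_closed_category = symmetric_monoidal_category +
  assumes dual_exists: "X \<in> Obj T \<Longrightarrow> \<exists>D. is_dual T X D"


section \<open>Vector spaces by generators and relations\<close>

definition free_vs :: "('k, 'c) ring_scheme \<Rightarrow> 's set \<Rightarrow> ('k, 's \<Rightarrow> 'k) module" where
  "free_vs K S = (ring.func_space K S)
     \<lparr>carrier := {f \<in> S \<rightarrow>\<^sub>E carrier K. finite {x \<in> S. f x \<noteq> \<zero>\<^bsub>K\<^esub>}}\<rparr>"

definition basis_vec :: "('k, 'c) ring_scheme \<Rightarrow> 's set \<Rightarrow> 's \<Rightarrow> 's \<Rightarrow> 'k" where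
  "basis_vec K S s = (\<lambda>x\<in>S. if x = s then \<one>\<^bsub>K\<^esub> else \<zero>\<^bsub>K\<^esub>)"

text \<open>\<^const>\<open>mult\<close> and \<^const>\<open>one\<close> are fields of the record \<open>module\<close> that play no role in the
  module structure.\<close>

definition quot_vs :: "('k, 'c) ring_scheme \<Rightarrow> ('k, 'v, 'd) module_scheme \<Rightarrow> 'v set
    \<Rightarrow> ('k, 'v set) module" where
  "quot_vs K V W = \<lparr>carrier = A_RCOSETS V W, mult = (\<lambda>_ _. W), one = W, zero = W,
     add = set_add V, smult = (\<lambda>a A. \<Union>x\<in>A. a_r_coset V W (a \<odot>\<^bsub>V\<^esub> x))\<rparr>"

definition presented :: "('k, 'c) ring_scheme \<Rightarrow> 's set \<Rightarrow> ('s \<Rightarrow> 'k) set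
    \<Rightarrow> ('k, ('s \<Rightarrow> 'k) set) module" where
  "presented K S R = quot_vs K (free_vs K S) (module.span K (free_vs K S) R)"

definition generator :: "('k, 'c) ring_scheme \<Rightarrow> 's set \<Rightarrow> ('s \<Rightarrow> 'k) set \<Rightarrow> 's \<Rightarrow> ('s \<Rightarrow> 'k) set" where
  "generator K S R s =
     a_r_coset (free_vs K S) (module.span K (free_vs K S) R) (basis_vec K S s)"

text \<open>The linear map \<open>V \<rightarrow> W\<close> that sends \<open>c s\<close> to \<open>\<phi> s\<close>, where the \<open>c s\<close> span \<open>V\<close>.\<close>

definition linear_map_with :: "('k, 'c) ring_scheme \<Rightarrow> ('k, 'v, 'd) module_scheme
    \<Rightarrow> ('k, 'w, 'e) module_scheme \<Rightarrow> 's set \<Rightarrow> ('s \<Rightarrow> 'v) \<Rightarrow> ('s \<Rightarrow> 'w) \<Rightarrow> 'v \<Rightarrow> 'w" where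
  "linear_map_with K V W S c \<phi> =
     (THE h. h \<in> module_hom K V W \<inter> extensional (carrier V) \<and> (\<forall>s\<in>S. h (c s) = \<phi> s))"


subsection \<open>The tensor product of vector spaces\<close>

definition vs_tensor_rels :: "('k, 'c) ring_scheme \<Rightarrow> ('k, 'v, 'd) module_scheme
    \<Rightarrow> ('k, 'w, 'e) module_scheme \<Rightarrow> ('v \<times> 'w \<Rightarrow> 'k) set" where
  "vs_tensor_rels K P Q =
    (let F = free_vs K (carrier P \<times> carrier Q); b = (\<lambda>x y. basis_vec K (carrier P \<times> carrier Q) (x, y)) in
       {b (x \<oplus>\<^bsub>P\<^esub> x') y \<ominus>\<^bsub>F\<^esub> (b x y \<oplus>\<^bsub>F\<^esub> b x' y) | x x' y.
          x \<in> carrier P \<and> x' \<in> carrier P \<and> y \<in> carrier Q}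
     \<union> {b x (y \<oplus>\<^bsub>Q\<^esub> y') \<ominus>\<^bsub>F\<^esub> (b x y \<oplus>\<^bsub>F\<^esub> b x y') | x y y'.
          x \<in> carrier P \<and> y \<in> carrier Q \<and> y' \<in> carrier Q}
     \<union> {b (a \<odot>\<^bsub>P\<^esub> x) y \<ominus>\<^bsub>F\<^esub> a \<odot>\<^bsub>F\<^esub> b x y | a x y.
          a \<in> carrier K \<and> x \<in> carrier P \<and> y \<in> carrier Q}
     \<union> {b x (a \<odot>\<^bsub>Q\<^esub> y) \<ominus>\<^bsub>F\<^esub> a \<odot>\<^bsub>F\<^esub> b x y | a x y.
          a \<in> carrier K \<and> x \<in> carrier P \<and> y \<in> carrier Q})"

definition vs_tensor :: "('k, 'c) ring_scheme \<Rightarrow> ('k, 'v, 'd) module_scheme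
    \<Rightarrow> ('k, 'w, 'e) module_scheme \<Rightarrow> ('k, ('v \<times> 'w \<Rightarrow> 'k) set) module" where
  "vs_tensor K P Q = presented K (carrier P \<times> carrier Q) (vs_tensor_rels K P Q)"

definition vs_pure :: "('k, 'c) ring_scheme \<Rightarrow> ('k, 'v, 'd) module_scheme
    \<Rightarrow> ('k, 'w, 'e) module_scheme \<Rightarrow> 'v \<times> 'w \<Rightarrow> ('v \<times> 'w \<Rightarrow> 'k) set" where
  "vs_pure K P Q = generator K (carrier P \<times> carrier Q) (vs_tensor_rels K P Q)"

definition vs_tensor_map :: "('k, 'c) ring_scheme \<Rightarrow> ('k, 'v, 'd) module_scheme
    \<Rightarrow> ('k, 'w, 'e) module_scheme \<Rightarrow> ('k, 'v2, 'd2) module_scheme \<Rightarrow> ('k, 'w2, 'e2) module_scheme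
    \<Rightarrow> ('v \<Rightarrow> 'v2) \<Rightarrow> ('w \<Rightarrow> 'w2) \<Rightarrow> ('v \<times> 'w \<Rightarrow> 'k) set \<Rightarrow> ('v2 \<times> 'w2 \<Rightarrow> 'k) set" where
  "vs_tensor_map K P Q P' Q' f g =
     linear_map_with K (vs_tensor K P Q) (vs_tensor K P' Q') (carrier P \<times> carrier Q)
       (vs_pure K P Q) (\<lambda>(x, y). vs_pure K P' Q' (f x, g y))"


subsection \<open>The tensor product of a commutative monoid and a vector space\<close>

text \<open>The vector space \<open>V \<otimes> P\<close> with \<open>Hom\<^sub>k(V \<otimes> P, Q) \<cong> Hom\<^bsub>CMon\<^esub>(V, Hom\<^sub>k(P, Q))\<close>; see
  \<open>cmon_tensor_context.universal\<close> below. A HOL-Algebra monoid \<open>V\<close> is written multiplicatively.\<close>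

definition cmon_tensor_rels :: "('k, 'c) ring_scheme \<Rightarrow> ('a, 'd) monoid_scheme
    \<Rightarrow> ('k, 'v, 'e) module_scheme \<Rightarrow> ('a \<times> 'v \<Rightarrow> 'k) set" where
  "cmon_tensor_rels K V P =
    (let F = free_vs K (carrier V \<times> carrier P); b = (\<lambda>v x. basis_vec K (carrier V \<times> carrier P) (v, x)) in
       {b (v \<otimes>\<^bsub>V\<^esub> v') x \<ominus>\<^bsub>F\<^esub> (b v x \<oplus>\<^bsub>F\<^esub> b v' x) | v v' x.
          v \<in> carrier V \<and> v' \<in> carrier V \<and> x \<in> carrier P}
     \<union> {b \<one>\<^bsub>V\<^esub> x | x. x \<in> carrier P}
     \<union> {b v (x \<oplus>\<^bsub>P\<^esub> x') \<ominus>\<^bsub>F\<^esub> (b v x \<oplus>\<^bsub>F\<^esub> b v x') | v x x'.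
          v \<in> carrier V \<and> x \<in> carrier P \<and> x' \<in> carrier P}
     \<union> {b v (a \<odot>\<^bsub>P\<^esub> x) \<ominus>\<^bsub>F\<^esub> a \<odot>\<^bsub>F\<^esub> b v x | a v x.
          a \<in> carrier K \<and> v \<in> carrier V \<and> x \<in> carrier P})"

definition cmon_tensor :: "('k, 'c) ring_scheme \<Rightarrow> ('a, 'd) monoid_scheme
    \<Rightarrow> ('k, 'v, 'e) module_scheme \<Rightarrow> ('k, ('a \<times> 'v \<Rightarrow> 'k) set) module" where
  "cmon_tensor K V P = presented K (carrier V \<times> carrier P) (cmon_tensor_rels K V P)"

definition cmon_pure :: "('k, 'c) ring_scheme \<Rightarrow> ('a, 'd) monoid_scheme
    \<Rightarrow> ('k, 'v, 'e) module_scheme \<Rightarrow> 'a \<times> 'v \<Rightarrow> ('a \<times> 'v \<Rightarrow> 'k) set" where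
  "cmon_pure K V P = generator K (carrier V \<times> carrier P) (cmon_tensor_rels K V P)"

definition cmon_tensor_map :: "('k, 'c) ring_scheme \<Rightarrow> ('a, 'd) monoid_scheme
    \<Rightarrow> ('k, 'v, 'e) module_scheme \<Rightarrow> ('a2, 'd2) monoid_scheme \<Rightarrow> ('k, 'v2, 'e2) module_scheme
    \<Rightarrow> ('a \<Rightarrow> 'a2) \<Rightarrow> ('v \<Rightarrow> 'v2) \<Rightarrow> ('a \<times> 'v \<Rightarrow> 'k) set \<Rightarrow> ('a2 \<times> 'v2 \<Rightarrow> 'k) set" where
  "cmon_tensor_map K V P V' P' f g =
     linear_map_with K (cmon_tensor K V P) (cmon_tensor K V' P') (carrier V \<times> carrier P)
       (cmon_pure K V P) (\<lambda>(v, x). cmon_pure K V' P' (f v, g x))"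


subsection \<open>Coends\<close>

text \<open>The integrand is contravariant in its first argument and covariant in the second: for
  \<open>g : A \<rightarrow> A'\<close> and \<open>f : B \<rightarrow> B'\<close>, \<open>F1 g f\<close> is a map \<open>F0 A' B \<rightarrow> F0 A B'\<close>.\<close>

definition coend_gens :: "('o, 'm, 'b) cat_scheme \<Rightarrow> ('o \<Rightarrow> 'o \<Rightarrow> ('k, 'v) module) \<Rightarrow> ('o \<times> 'v) set" where
  "coend_gens C F0 = (SIGMA X : Obj C. carrier (F0 X X))"

definition coend_rels :: "('k, 'c) ring_scheme \<Rightarrow> ('o, 'm, 'b) cat_scheme
    \<Rightarrow> ('o \<Rightarrow> 'o \<Rightarrow> ('k, 'v) module) \<Rightarrow> ('m \<Rightarrow> 'm \<Rightarrow> 'v \<Rightarrow> 'v) \<Rightarrow> ('o \<times> 'v \<Rightarrow> 'k) set" where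
  "coend_rels K C F0 F1 =
    (let S = coend_gens C F0; F = free_vs K S; b = (\<lambda>X x. basis_vec K S (X, x)) in
       {b X (x \<oplus>\<^bsub>F0 X X\<^esub> y) \<ominus>\<^bsub>F\<^esub> (b X x \<oplus>\<^bsub>F\<^esub> b X y) | X x y.
          X \<in> Obj C \<and> x \<in> carrier (F0 X X) \<and> y \<in> carrier (F0 X X)}
     \<union> {b X (a \<odot>\<^bsub>F0 X X\<^esub> x) \<ominus>\<^bsub>F\<^esub> a \<odot>\<^bsub>F\<^esub> b X x | a X x.
          a \<in> carrier K \<and> X \<in> Obj C \<and> x \<in> carrier (F0 X X)}
     \<union> {b (Dom C f) (F1 f (Ide C (Dom C f)) x) \<ominus>\<^bsub>F\<^esub> b (Cod C f) (F1 (Ide C (Cod C f)) f x) | f x.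
          f \<in> Arr C \<and> x \<in> carrier (F0 (Cod C f) (Dom C f))})"

definition coend :: "('k, 'c) ring_scheme \<Rightarrow> ('o, 'm, 'b) cat_scheme
    \<Rightarrow> ('o \<Rightarrow> 'o \<Rightarrow> ('k, 'v) module) \<Rightarrow> ('m \<Rightarrow> 'm \<Rightarrow> 'v \<Rightarrow> 'v)
    \<Rightarrow> ('k, ('o \<times> 'v \<Rightarrow> 'k) set) module" where
  "coend K C F0 F1 = presented K (coend_gens C F0) (coend_rels K C F0 F1)"

definition coend_in :: "('k, 'c) ring_scheme \<Rightarrow> ('o, 'm, 'b) cat_scheme
    \<Rightarrow> ('o \<Rightarrow> 'o \<Rightarrow> ('k, 'v) module) \<Rightarrow> ('m \<Rightarrow> 'm \<Rightarrow> 'v \<Rightarrow> 'v)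
    \<Rightarrow> 'o \<times> 'v \<Rightarrow> ('o \<times> 'v \<Rightarrow> 'k) set" where
  "coend_in K C F0 F1 = generator K (coend_gens C F0) (coend_rels K C F0 F1)"


section \<open>Mackey functors\<close>

record ('o, 'm, 'k, 'v) vfunctor =
  fobj :: "'o \<Rightarrow> ('k, 'v) module"
  farr :: "'m \<Rightarrow> 'v \<Rightarrow> 'v"

locale mackey_functor =
  fixes K :: "('k, 'c) ring_scheme" and T :: "('o, 'm, 'b) sm_cat_scheme"
    and M :: "('o, 'm, 'k, 'v) vfunctor"
  assumes fobj_vs: "X \<in> Obj T \<Longrightarrow> vectorspace K (fobj M X)"
    and farr_hom: "f \<in> Hom T X Y \<Longrightarrow> farr M f \<in> module_hom K (fobj M X) (fobj M Y)"
    and farr_Ide: "X \<in> Obj T \<Longrightarrow> x \<in> carrier (fobj M X) \<Longrightarrow> farr M (Ide T X) x = x"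
    and farr_Comp: "f \<in> Hom T X Y \<Longrightarrow> g \<in> Hom T Y Z \<Longrightarrow> x \<in> carrier (fobj M X) \<Longrightarrow>
      farr M (g \<cdot>\<^bsub>T\<^esub> f) x = farr M g (farr M f x)"
    and farr_add: "f \<in> Hom T X Y \<Longrightarrow> g \<in> Hom T X Y \<Longrightarrow> x \<in> carrier (fobj M X) \<Longrightarrow>
      farr M (add_arr T f g) x = farr M f x \<oplus>\<^bsub>fobj M Y\<^esub> farr M g x"
    and farr_zero: "X \<in> Obj T \<Longrightarrow> Y \<in> Obj T \<Longrightarrow> x \<in> carrier (fobj M X) \<Longrightarrow>
      farr M (zero_arr T X Y) x = \<zero>\<^bsub>fobj M Y\<^esub>"

definition fin_dim_mackey_functor :: "('k, 'c) ring_scheme \<Rightarrow> ('o, 'm, 'b) sm_cat_scheme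
    \<Rightarrow> ('o, 'm, 'k, 'v) vfunctor \<Rightarrow> bool" where
  "fin_dim_mackey_functor K T M \<longleftrightarrow> mackey_functor K T M \<and>
     (\<forall>X \<in> Obj T. vectorspace.fin_dim K (fobj M X))"


subsection \<open>Day convolution\<close>

text \<open>The integrand of the coend over \<open>X, Y\<close> of \<open>T(X \<otimes> Y, Z) \<otimes> M(X) \<otimes>\<^sub>k N(Y)\<close>. It is additive in
  every variable, so the two legs of a cowedge, which are homomorphisms of commutative monoids
  on \<open>T(X, X') \<otimes> T(Y, Y')\<close>, agree as soon as they agree at the pairs \<open>(f, g)\<close> that generate it.
  Hence the enriched coend is the coend over \<^term>\<open>prod_cat T T\<close>.\<close>

definition day_integrand_obj :: "('k, 'c) ring_scheme \<Rightarrow> ('o, 'm, 'b) sm_cat_scheme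
    \<Rightarrow> ('o, 'm, 'k, 'v) vfunctor \<Rightarrow> ('o, 'm, 'k, 'w) vfunctor \<Rightarrow> 'o \<Rightarrow> 'o \<times> 'o \<Rightarrow> 'o \<times> 'o
    \<Rightarrow> ('k, ('m \<times> ('v \<times> 'w \<Rightarrow> 'k) set \<Rightarrow> 'k) set) module" where
  "day_integrand_obj K T M N Z = (\<lambda>(X', Y') (X, Y).
     cmon_tensor K (hom_monoid T (X' \<boxtimes>\<^bsub>T\<^esub> Y') Z) (vs_tensor K (fobj M X) (fobj N Y)))"

definition day_integrand_arr :: "('k, 'c) ring_scheme \<Rightarrow> ('o, 'm, 'b) sm_cat_scheme
    \<Rightarrow> ('o, 'm, 'k, 'v) vfunctor \<Rightarrow> ('o, 'm, 'k, 'w) vfunctor \<Rightarrow> 'o \<Rightarrow> 'm \<times> 'm \<Rightarrow> 'm \<times> 'm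
    \<Rightarrow> ('m \<times> ('v \<times> 'w \<Rightarrow> 'k) set \<Rightarrow> 'k) set \<Rightarrow> ('m \<times> ('v \<times> 'w \<Rightarrow> 'k) set \<Rightarrow> 'k) set" where
  "day_integrand_arr K T M N Z = (\<lambda>(f', g') (f, g).
     cmon_tensor_map K
       (hom_monoid T (Cod T f' \<boxtimes>\<^bsub>T\<^esub> Cod T g') Z) (vs_tensor K (fobj M (Dom T f)) (fobj N (Dom T g)))
       (hom_monoid T (Dom T f' \<boxtimes>\<^bsub>T\<^esub> Dom T g') Z) (vs_tensor K (fobj M (Cod T f)) (fobj N (Cod T g)))
       (\<lambda>t. t \<cdot>\<^bsub>T\<^esub> (f' \<boxtimes>\<^sub>a\<^bsub>T\<^esub> g'))
       (vs_tensor_map K (fobj M (Dom T f)) (fobj N (Dom T g)) (fobj M (Cod T f)) (fobj N (Cod T g))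
          (farr M f) (farr N g)))"

definition day_obj :: "('k, 'c) ring_scheme \<Rightarrow> ('o, 'm, 'b) sm_cat_scheme
    \<Rightarrow> ('o, 'm, 'k, 'v) vfunctor \<Rightarrow> ('o, 'm, 'k, 'w) vfunctor \<Rightarrow> 'o
    \<Rightarrow> ('k, (('o \<times> 'o) \<times> ('m \<times> ('v \<times> 'w \<Rightarrow> 'k) set \<Rightarrow> 'k) set \<Rightarrow> 'k) set) module" where
  "day_obj K T M N Z =
     coend K (prod_cat T T) (day_integrand_obj K T M N Z) (day_integrand_arr K T M N Z)"

definition day_in :: "('k, 'c) ring_scheme \<Rightarrow> ('o, 'm, 'b) sm_cat_scheme
    \<Rightarrow> ('o, 'm, 'k, 'v) vfunctor \<Rightarrow> ('o, 'm, 'k, 'w) vfunctor \<Rightarrow> 'o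
    \<Rightarrow> ('o \<times> 'o) \<times> ('m \<times> ('v \<times> 'w \<Rightarrow> 'k) set \<Rightarrow> 'k) set
    \<Rightarrow> (('o \<times> 'o) \<times> ('m \<times> ('v \<times> 'w \<Rightarrow> 'k) set \<Rightarrow> 'k) set \<Rightarrow> 'k) set" where
  "day_in K T M N Z =
     coend_in K (prod_cat T T) (day_integrand_obj K T M N Z) (day_integrand_arr K T M N Z)"

text \<open>The functoriality of \<open>M * N\<close> in \<open>Z\<close> is induced by postcomposition
  \<open>T(X \<otimes> Y, Z) \<rightarrow> T(X \<otimes> Y, Z')\<close>.\<close>

definition day_arr :: "('k, 'c) ring_scheme \<Rightarrow> ('o, 'm, 'b) sm_cat_scheme
    \<Rightarrow> ('o, 'm, 'k, 'v) vfunctor \<Rightarrow> ('o, 'm, 'k, 'w) vfunctor \<Rightarrow> 'm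
    \<Rightarrow> (('o \<times> 'o) \<times> ('m \<times> ('v \<times> 'w \<Rightarrow> 'k) set \<Rightarrow> 'k) set \<Rightarrow> 'k) set
    \<Rightarrow> (('o \<times> 'o) \<times> ('m \<times> ('v \<times> 'w \<Rightarrow> 'k) set \<Rightarrow> 'k) set \<Rightarrow> 'k) set" where
  "day_arr K T M N h =
     linear_map_with K (day_obj K T M N (Dom T h)) (day_obj K T M N (Cod T h))
       (coend_gens (prod_cat T T) (day_integrand_obj K T M N (Dom T h)))
       (day_in K T M N (Dom T h))
       (\<lambda>((X, Y), w). day_in K T M N (Cod T h) ((X, Y),
          cmon_tensor_map K
            (hom_monoid T (X \<boxtimes>\<^bsub>T\<^esub> Y) (Dom T h)) (vs_tensor K (fobj M X) (fobj N Y))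
            (hom_monoid T (X \<boxtimes>\<^bsub>T\<^esub> Y) (Cod T h)) (vs_tensor K (fobj M X) (fobj N Y))
            (\<lambda>t. h \<cdot>\<^bsub>T\<^esub> t) (\<lambda>x. x) w))"

definition day_convolution :: "('k, 'c) ring_scheme \<Rightarrow> ('o, 'm, 'b) sm_cat_scheme
    \<Rightarrow> ('o, 'm, 'k, 'v) vfunctor \<Rightarrow> ('o, 'm, 'k, 'w) vfunctor
    \<Rightarrow> ('o, 'm, 'k, (('o \<times> 'o) \<times> ('m \<times> ('v \<times> 'w \<Rightarrow> 'k) set \<Rightarrow> 'k) set \<Rightarrow> 'k) set) vfunctor" where
  "day_convolution K T M N = \<lparr>fobj = day_obj K T M N, farr = day_arr K T M N\<rparr>"


section \<open>Universal properties of the constructions\<close>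

text \<open>What follows is not needed to read the definitions above: it shows that the constructions by
  generators and relations have the intended universal properties.\<close>

subsection \<open>Generators and relations\<close>

lemma free_carrier: "ring K \<Longrightarrow> carrier (free_vs K S) = {f \<in> S \<rightarrow>\<^sub>E carrier K. finite {x \<in> S. f x \<noteq> \<zero>\<^bsub>K\<^esub>}}"
  by (simp add: free_vs_def)

lemma free_vs_module:
  assumes "cring K" shows "module K (free_vs K S)"
proof -
  interpret cring K by fact
  interpret fs: module K "func_space S" by (rule func_space_is_module)
  have "LinearCombinations.submodule K {f \<in> S \<rightarrow>\<^sub>E carrier K. finite {x \<in> S. f x \<noteq> \<zero>\<^bsub>K\<^esub>}} (func_space S)"
  proof (intro submodule.intro, goal_cases)
    case 1 show ?case by (rule fs.module_axioms)
  next
    case 2 then show ?case by (auto simp: func_space_def)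
  next
    case (3 v w)
    have "finite ({x \<in> S. v x \<noteq> \<zero>\<^bsub>K\<^esub>} \<union> {x \<in> S. w x \<noteq> \<zero>\<^bsub>K\<^esub>})" using 3 by auto
    moreover have "{x \<in> S. v x \<oplus>\<^bsub>K\<^esub> w x \<noteq> \<zero>\<^bsub>K\<^esub>} \<subseteq> {x \<in> S. v x \<noteq> \<zero>\<^bsub>K\<^esub>} \<union> {x \<in> S. w x \<noteq> \<zero>\<^bsub>K\<^esub>}" by auto
    ultimately have "finite {x \<in> S. v x \<oplus>\<^bsub>K\<^esub> w x \<noteq> \<zero>\<^bsub>K\<^esub>}" by (rule finite_subset[rotated])
    then show ?case using 3 by (auto simp: func_space_def PiE_mem cong: conj_cong)
  next
    case 4 then show ?case by (auto simp: func_space_def cong: conj_cong)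
  next
    case (5 c v)
    have "{x \<in> S. c \<otimes>\<^bsub>K\<^esub> v x \<noteq> \<zero>\<^bsub>K\<^esub>} \<subseteq> {x \<in> S. v x \<noteq> \<zero>\<^bsub>K\<^esub>}" using 5 by (auto)
    with 5 have "finite {x \<in> S. c \<otimes>\<^bsub>K\<^esub> v x \<noteq> \<zero>\<^bsub>K\<^esub>}" by (auto intro: finite_subset)
    with 5 show ?case by (auto simp: func_space_def PiE_mem cong: conj_cong)
  qed
  from fs.submodule_is_module[OF this] show ?thesis by (simp add: free_vs_def)
qed

lemma free_vs_simps:
  assumes "ring K"
  shows "f \<oplus>\<^bsub>free_vs K S\<^esub> g = (\<lambda>x\<in>S. f x \<oplus>\<^bsub>K\<^esub> g x)"
    "\<zero>\<^bsub>free_vs K S\<^esub> = (\<lambda>x\<in>S. \<zero>\<^bsub>K\<^esub>)"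
    "a \<odot>\<^bsub>free_vs K S\<^esub> f = (\<lambda>x\<in>S. a \<otimes>\<^bsub>K\<^esub> f x)"
  using assms by (simp_all add: free_vs_def ring.func_space_def)

lemma basis_vec_closed:
  assumes "ring K" shows "basis_vec K S s \<in> carrier (free_vs K S)"
proof -
  interpret ring K by fact
  have "finite {x \<in> S. basis_vec K S s x \<noteq> \<zero>\<^bsub>K\<^esub>}"
    by (rule finite_subset[of _ "{s}"]) (auto simp: basis_vec_def)
  then show ?thesis by (auto simp: free_carrier[OF assms] basis_vec_def)
qed

lemma free_vs_induct [consumes 2, case_names zero step]:
  assumes "cring K" and f: "f \<in> carrier (free_vs K S)"
    and z: "P \<zero>\<^bsub>free_vs K S\<^esub>"
    and st: "\<And>f a s. f \<in> carrier (free_vs K S) \<Longrightarrow> a \<in> carrier K \<Longrightarrow> s \<in> S \<Longrightarrow> P f \<Longrightarrow>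
      P (f \<oplus>\<^bsub>free_vs K S\<^esub> a \<odot>\<^bsub>free_vs K S\<^esub> basis_vec K S s)"
  shows "P f"
proof -
  interpret cring K by fact
  note R = ring_axioms
  have "P f" if "finite A" "f \<in> carrier (free_vs K S)" "{x \<in> S. f x \<noteq> \<zero>\<^bsub>K\<^esub>} = A" for A f
    using that
  proof (induction A arbitrary: f)
    case empty
    then have "f = \<zero>\<^bsub>free_vs K S\<^esub>"
      by (auto simp: free_carrier[OF R] free_vs_simps[OF R] fun_eq_iff restrict_def PiE_def extensional_def)
    with z show ?case by simp
  next
    case (insert s A)
    define g where "g = (\<lambda>x\<in>S. if x = s then \<zero>\<^bsub>K\<^esub> else f x)"
    have s: "s \<in> S" using insert by auto
    have fc: "f x \<in> carrier K" if "x \<in> S" for x using insert.prems that by (auto simp: free_carrier[OF R])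
    have gA: "{x \<in> S. g x \<noteq> \<zero>\<^bsub>K\<^esub>} = A" using insert.prems insert.hyps by (auto simp: g_def)
    have gc: "g \<in> carrier (free_vs K S)"
      using gA insert.hyps fc by (auto simp: free_carrier[OF R] g_def)
    have "f = g \<oplus>\<^bsub>free_vs K S\<^esub> f s \<odot>\<^bsub>free_vs K S\<^esub> basis_vec K S s"
      using fc s insert.prems(1)
      by (auto simp: free_vs_simps[OF R] g_def basis_vec_def fun_eq_iff free_carrier[OF R] PiE_def extensional_def)
    moreover have "P (g \<oplus>\<^bsub>free_vs K S\<^esub> f s \<odot>\<^bsub>free_vs K S\<^esub> basis_vec K S s)"
      using st[OF gc fc[OF s] s insert.IH[OF gc gA]] .
    ultimately show ?case by simp
  qed
  with f show ?thesis by (auto simp: free_carrier[OF R])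
qed

lemma free_vs_lift:
  assumes Q: "module K Q" and phi: "\<And>s. s \<in> S \<Longrightarrow> \<phi> s \<in> carrier Q"
  obtains u where "u \<in> module_hom K (free_vs K S) Q" "\<And>s. s \<in> S \<Longrightarrow> u (basis_vec K S s) = \<phi> s"
proof -
  interpret Q: module K Q by fact
  note R = Q.R.ring_axioms
  interpret F: module K "free_vs K S" by (rule free_vs_module) (rule Q.R.cring_axioms)
  define supp where "supp = (\<lambda>f. {x \<in> S. f x \<noteq> \<zero>\<^bsub>K\<^esub>})"
  define u where "u = (\<lambda>f. \<Oplus>\<^bsub>Q\<^esub>x\<in>supp f. f x \<odot>\<^bsub>Q\<^esub> \<phi> x)"
  have fin: "finite (supp f)" if "f \<in> carrier (free_vs K S)" for f
    using that by (simp add: free_carrier[OF R] supp_def)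
  have fc: "f x \<in> carrier K" if "f \<in> carrier (free_vs K S)" "x \<in> S" for f x
    using that by (auto simp: free_carrier[OF R])
  have ext: "u f = (\<Oplus>\<^bsub>Q\<^esub>x\<in>A. f x \<odot>\<^bsub>Q\<^esub> \<phi> x)"
    if "f \<in> carrier (free_vs K S)" "finite A" "supp f \<subseteq> A" "A \<subseteq> S" for f A
    unfolding u_def
  proof (rule Q.add.finprod_mono_neutral_cong_left)
    show "\<And>i. i \<in> A - supp f \<Longrightarrow> f i \<odot>\<^bsub>Q\<^esub> \<phi> i = \<zero>\<^bsub>Q\<^esub>"
      using that phi by (auto simp: supp_def)
    show "(\<lambda>x. f x \<odot>\<^bsub>Q\<^esub> \<phi> x) \<in> A \<rightarrow> carrier Q"
      using that phi fc by (auto simp: supp_def)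
  qed (use that in auto)
  have "u \<in> module_hom K (free_vs K S) Q"
    unfolding module_hom_def
  proof (safe)
    fix f assume f: "f \<in> carrier (free_vs K S)"
    show "u f \<in> carrier Q" unfolding u_def
      by (rule Q.finsum_closed) (use f fc phi in \<open>auto simp: supp_def\<close>)
  next
    fix f g assume f: "f \<in> carrier (free_vs K S)" and g: "g \<in> carrier (free_vs K S)"
    let ?A = "supp f \<union> supp g"
    have A: "finite ?A" "?A \<subseteq> S" using fin f g by (auto simp: supp_def)
    have "supp (f \<oplus>\<^bsub>free_vs K S\<^esub> g) \<subseteq> ?A" by (auto simp: supp_def free_vs_simps[OF R])
    then have "u (f \<oplus>\<^bsub>free_vs K S\<^esub> g) = (\<Oplus>\<^bsub>Q\<^esub>x\<in>?A. (f \<oplus>\<^bsub>free_vs K S\<^esub> g) x \<odot>\<^bsub>Q\<^esub> \<phi> x)"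
      using A f g by (intro ext) auto
    also have "\<dots> = (\<Oplus>\<^bsub>Q\<^esub>x\<in>?A. f x \<odot>\<^bsub>Q\<^esub> \<phi> x \<oplus>\<^bsub>Q\<^esub> g x \<odot>\<^bsub>Q\<^esub> \<phi> x)"
      using A(2) fc[OF f] fc[OF g] phi
      by (intro Q.finsum_cong') (auto simp: free_vs_simps[OF R] Q.smult_l_distr subset_iff)
    also have "\<dots> = (\<Oplus>\<^bsub>Q\<^esub>x\<in>?A. f x \<odot>\<^bsub>Q\<^esub> \<phi> x) \<oplus>\<^bsub>Q\<^esub> (\<Oplus>\<^bsub>Q\<^esub>x\<in>?A. g x \<odot>\<^bsub>Q\<^esub> \<phi> x)"
      using A(2) fc[OF f] fc[OF g] phi by (intro Q.finsum_addf) (auto simp: subset_iff)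
    also have "\<dots> = u f \<oplus>\<^bsub>Q\<^esub> u g" using ext[OF f A(1) _ A(2)] ext[OF g A(1) _ A(2)] by simp
    finally show "u (f \<oplus>\<^bsub>free_vs K S\<^esub> g) = u f \<oplus>\<^bsub>Q\<^esub> u g" .
  next
    fix a f assume a: "a \<in> carrier K" and f: "f \<in> carrier (free_vs K S)"
    let ?A = "supp f"
    have A: "finite ?A" "?A \<subseteq> S" using fin f by (auto simp: supp_def)
    have "supp (a \<odot>\<^bsub>free_vs K S\<^esub> f) \<subseteq> ?A" using a by (auto simp: supp_def free_vs_simps[OF R])
    then have "u (a \<odot>\<^bsub>free_vs K S\<^esub> f) = (\<Oplus>\<^bsub>Q\<^esub>x\<in>?A. (a \<odot>\<^bsub>free_vs K S\<^esub> f) x \<odot>\<^bsub>Q\<^esub> \<phi> x)"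
      using A f a by (intro ext) auto
    also have "\<dots> = (\<Oplus>\<^bsub>Q\<^esub>x\<in>?A. a \<odot>\<^bsub>Q\<^esub> (f x \<odot>\<^bsub>Q\<^esub> \<phi> x))"
      using A(2) fc[OF f] a phi
      by (intro Q.finsum_cong') (auto simp: free_vs_simps[OF R] Q.smult_assoc1 subset_iff)
    also have "\<dots> = a \<odot>\<^bsub>Q\<^esub> u f" unfolding u_def
      using A fc[OF f] a phi by (intro Q.finsum_smult_ldistr[symmetric]) (auto simp: subset_iff)
    finally show "u (a \<odot>\<^bsub>free_vs K S\<^esub> f) = a \<odot>\<^bsub>Q\<^esub> u f" .
  qed
  moreover have "u (basis_vec K S s) = \<phi> s" if "s \<in> S" for s
  proof -
    have "u (basis_vec K S s) = (\<Oplus>\<^bsub>Q\<^esub>x\<in>{s}. basis_vec K S s x \<odot>\<^bsub>Q\<^esub> \<phi> x)"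
      using that basis_vec_closed[OF R] by (intro ext) (auto simp: supp_def basis_vec_def)
    then show ?thesis using that phi by (simp add: basis_vec_def)
  qed
  ultimately show ?thesis using that by blast
qed


lemma submodule_abelian_subgroup:
  assumes V: "module K V" and W: "LinearCombinations.submodule K W V"
  shows "abelian_subgroup W V"
proof -
  interpret V: module K V by fact
  interpret W: LinearCombinations.submodule K W V by fact
  show ?thesis
  proof (intro abelian_subgroupI3 additive_subgroupI V.abelian_group_axioms)
    show "subgroup W (add_monoid V)"
    proof (rule V.add.subgroupI)
      show "W \<subseteq> carrier V" by (rule W.subset)
      show "W \<noteq> {}" using W.zero_closed by blast
      show "a \<oplus>\<^bsub>V\<^esub> b \<in> W" if "a \<in> W" "b \<in> W" for a b using that by (rule W.m_closed)
      fix a assume a: "a \<in> W"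
      then have aV: "a \<in> carrier V" using W.subset by auto
      then have "\<ominus>\<^bsub>V\<^esub> a = (\<ominus>\<^bsub>K\<^esub> \<one>\<^bsub>K\<^esub>) \<odot>\<^bsub>V\<^esub> a"
        using V.smult_l_minus[OF V.R.one_closed aV] V.smult_one[OF aV] by simp
      also have "\<dots> \<in> W" by (rule W.smult_closed) (simp_all add: a)
      finally show "\<ominus>\<^bsub>V\<^esub> a \<in> W" .
    qed
  qed
qed

lemma
  assumes V: "module K V" and W: "LinearCombinations.submodule K W V"
  shows quot_carrier: "carrier (quot_vs K V W) = a_r_coset V W ` carrier V"
    and quot_add: "\<And>x y. x \<in> carrier V \<Longrightarrow> y \<in> carrier V \<Longrightarrow>
      a_r_coset V W x \<oplus>\<^bsub>quot_vs K V W\<^esub> a_r_coset V W y = a_r_coset V W (x \<oplus>\<^bsub>V\<^esub> y)"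
    and quot_zero: "\<zero>\<^bsub>quot_vs K V W\<^esub> = a_r_coset V W \<zero>\<^bsub>V\<^esub>"
    and quot_smult: "\<And>a x. a \<in> carrier K \<Longrightarrow> x \<in> carrier V \<Longrightarrow>
      a \<odot>\<^bsub>quot_vs K V W\<^esub> a_r_coset V W x = a_r_coset V W (a \<odot>\<^bsub>V\<^esub> x)"
    and quot_eq: "\<And>x y. x \<in> carrier V \<Longrightarrow> y \<in> carrier V \<Longrightarrow>
      a_r_coset V W x = a_r_coset V W y \<longleftrightarrow> x \<ominus>\<^bsub>V\<^esub> y \<in> W"
proof -
  interpret V: module K V by fact
  interpret W: LinearCombinations.submodule K W V by fact
  interpret AW: abelian_subgroup W V by (rule submodule_abelian_subgroup[OF V W])
  show "carrier (quot_vs K V W) = a_r_coset V W ` carrier V"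
    by (auto simp: quot_vs_def A_RCOSETS_def')
  show "a_r_coset V W x \<oplus>\<^bsub>quot_vs K V W\<^esub> a_r_coset V W y = a_r_coset V W (x \<oplus>\<^bsub>V\<^esub> y)"
    if "x \<in> carrier V" "y \<in> carrier V" for x y
    using AW.a_rcos_sum[OF that] by (simp add: quot_vs_def)
  show "\<zero>\<^bsub>quot_vs K V W\<^esub> = a_r_coset V W \<zero>\<^bsub>V\<^esub>"
    using W.subset by (simp add: quot_vs_def)
  show eq: "a_r_coset V W x = a_r_coset V W y \<longleftrightarrow> x \<ominus>\<^bsub>V\<^esub> y \<in> W"
    if "x \<in> carrier V" "y \<in> carrier V" for x y
    using AW.a_rcos_module[OF that(2,1)] AW.a_rcos_self[OF that(1)] that
      V.a_repr_independence[OF _ that(2) AW.a_subgroup, of x]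
    by (auto simp: a_minus_def)
  show "a \<odot>\<^bsub>quot_vs K V W\<^esub> a_r_coset V W x = a_r_coset V W (a \<odot>\<^bsub>V\<^esub> x)"
    if a: "a \<in> carrier K" and x: "x \<in> carrier V" for a x
  proof -
    have "a_r_coset V W (a \<odot>\<^bsub>V\<^esub> y) = a_r_coset V W (a \<odot>\<^bsub>V\<^esub> x)" if y: "y \<in> a_r_coset V W x" for y
    proof -
      have yc: "y \<in> carrier V" using subsetD[OF V.a_r_coset_subset_G[OF W.subset x] y] .
      have "y \<ominus>\<^bsub>V\<^esub> x \<in> W" using y AW.a_rcos_module[OF x yc] by (simp add: a_minus_def)
      then have "a \<odot>\<^bsub>V\<^esub> (y \<ominus>\<^bsub>V\<^esub> x) \<in> W" by (rule W.smult_closed[OF a])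
      also have "a \<odot>\<^bsub>V\<^esub> (y \<ominus>\<^bsub>V\<^esub> x) = a \<odot>\<^bsub>V\<^esub> y \<ominus>\<^bsub>V\<^esub> a \<odot>\<^bsub>V\<^esub> x"
        using a x yc by (simp add: a_minus_def V.smult_r_distr V.smult_r_minus)
      finally show ?thesis using a x yc by (subst eq) auto
    qed
    then have "(\<Union>y\<in>a_r_coset V W x. a_r_coset V W (a \<odot>\<^bsub>V\<^esub> y))
        = (\<Union>y\<in>a_r_coset V W x. a_r_coset V W (a \<odot>\<^bsub>V\<^esub> x))"
      by (rule SUP_cong[OF refl])
    also have "\<dots> = a_r_coset V W (a \<odot>\<^bsub>V\<^esub> x)"
      using AW.a_rcos_self[OF x] by blast
    finally show ?thesis by (simp only: quot_vs_def module.simps)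
  qed
qed


lemma quot_module:
  assumes V: "module K V" and W: "LinearCombinations.submodule K W V"
  shows "module K (quot_vs K V W)"
proof -
  interpret V: module K V by fact
  note [simp] = quot_carrier[OF V W] quot_add[OF V W] quot_zero[OF V W] quot_smult[OF V W]
  show ?thesis
  proof (rule module_criteria)
    show "\<forall>v\<in>carrier (quot_vs K V W). \<exists>neg_v\<in>carrier (quot_vs K V W).
        v \<oplus>\<^bsub>quot_vs K V W\<^esub> neg_v = \<zero>\<^bsub>quot_vs K V W\<^esub>"
    proof
      fix v assume "v \<in> carrier (quot_vs K V W)"
      then obtain x where x: "x \<in> carrier V" "v = a_r_coset V W x" by auto
      then show "\<exists>neg_v\<in>carrier (quot_vs K V W). v \<oplus>\<^bsub>quot_vs K V W\<^esub> neg_v = \<zero>\<^bsub>quot_vs K V W\<^esub>"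
        by (intro bexI[of _ "a_r_coset V W (\<ominus>\<^bsub>V\<^esub> x)"]) (auto simp: V.r_neg)
    qed
  qed (auto simp: V.R.cring_axioms V.a_ac V.smult_assoc1 V.smult_l_distr V.smult_r_distr)
qed

lemma quot_proj_hom:
  assumes V: "module K V" and W: "LinearCombinations.submodule K W V"
  shows "a_r_coset V W \<in> module_hom K V (quot_vs K V W)"
  by (auto simp: module_hom_def quot_carrier[OF V W] quot_add[OF V W] quot_smult[OF V W])

lemma quot_lift:
  assumes V: "module K V" and W: "LinearCombinations.submodule K W V" and Q: "module K Q"
    and u: "u \<in> module_hom K V Q" and uW: "\<And>w. w \<in> W \<Longrightarrow> u w = \<zero>\<^bsub>Q\<^esub>"
  shows "\<exists>h. h \<in> module_hom K (quot_vs K V W) Q \<and> (\<forall>x\<in>carrier V. h (a_r_coset V W x) = u x)"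
proof -
  interpret V: module K V by fact
  interpret Q: module K Q by fact
  interpret u: mod_hom K V Q u by unfold_locales (rule u)
  define h where "h = (\<lambda>A. u (SOME x. x \<in> carrier V \<and> A = a_r_coset V W x))"
  have h: "h (a_r_coset V W x) = u x" if x: "x \<in> carrier V" for x
  proof -
    define y where "y = (SOME y. y \<in> carrier V \<and> a_r_coset V W x = a_r_coset V W y)"
    have y: "y \<in> carrier V \<and> a_r_coset V W x = a_r_coset V W y"
      unfolding y_def by (rule someI[of _ x]) (use x in simp)
    with x have "x \<ominus>\<^bsub>V\<^esub> y \<in> W" using quot_eq[OF V W] by blast
    then have "u x \<ominus>\<^bsub>Q\<^esub> u y = \<zero>\<^bsub>Q\<^esub>" using uW x y u.f_minus by metis
    then have "\<ominus>\<^bsub>Q\<^esub> (\<ominus>\<^bsub>Q\<^esub> u y) = u x"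
      using x y by (intro Q.minus_equality) (simp_all add: a_minus_def)
    then have "u x = u y" using x y by simp
    then show ?thesis by (simp add: h_def y_def)
  qed
  have "h \<in> module_hom K (quot_vs K V W) Q"
    by (auto simp: module_hom_def quot_carrier[OF V W] quot_add[OF V W] quot_smult[OF V W] h)
  then show ?thesis using h by auto
qed


locale presentation =
  fixes K :: "('k, 'c) ring_scheme" and S :: "'s set" and R :: "('s \<Rightarrow> 'k) set"
  assumes cring_K: "cring K" and rels: "R \<subseteq> carrier (free_vs K S)"
begin

lemma F: "module K (free_vs K S)" by (rule free_vs_module[OF cring_K])

lemma span_sub: "LinearCombinations.submodule K (module.span K (free_vs K S) R) (free_vs K S)"
  by (rule module.span_is_submodule[OF F rels])

lemma module_presented: "module K (presented K S R)"
  unfolding presented_def by (rule quot_module[OF F span_sub])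

lemma generator_closed: "generator K S R s \<in> carrier (presented K S R)"
  unfolding presented_def generator_def quot_carrier[OF F span_sub]
  by (rule imageI, rule basis_vec_closed, rule cring.axioms(1)[OF cring_K])

definition proj where "proj = a_r_coset (free_vs K S) (module.span K (free_vs K S) R)"

lemma proj_hom: "proj \<in> module_hom K (free_vs K S) (presented K S R)"
  unfolding presented_def proj_def by (rule quot_proj_hom[OF F span_sub])

lemma proj_surj: "carrier (presented K S R) = proj ` carrier (free_vs K S)"
  unfolding presented_def proj_def quot_carrier[OF F span_sub] ..

lemma proj_basis: "proj (basis_vec K S s) = generator K S R s"
  by (simp add: proj_def generator_def)

lemma proj_rel: assumes "r \<in> R" shows "proj r = \<zero>\<^bsub>presented K S R\<^esub>"
proof -
  interpret F: module K "free_vs K S" by (rule F)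
  have r: "r \<in> carrier (free_vs K S)" using assms rels by auto
  interpret A: abelian_subgroup "module.span K (free_vs K S) R" "free_vs K S"
    by (rule submodule_abelian_subgroup[OF F span_sub])
  have "r \<in> module.span K (free_vs K S) R" using assms F.in_own_span[OF rels] by auto
  then show ?thesis
    using F.a_coset_join2[OF r A.a_subgroup] by (simp add: proj_def presented_def quot_vs_def)
qed

lemma presented_induct [consumes 1, case_names zero step]:
  assumes "x \<in> carrier (presented K S R)" and z: "P \<zero>\<^bsub>presented K S R\<^esub>"
    and st: "\<And>x a s. x \<in> carrier (presented K S R) \<Longrightarrow> a \<in> carrier K \<Longrightarrow> s \<in> S \<Longrightarrow> P x \<Longrightarrow>
      P (x \<oplus>\<^bsub>presented K S R\<^esub> a \<odot>\<^bsub>presented K S R\<^esub> generator K S R s)"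
  shows "P x"
proof -
  interpret F: module K "free_vs K S" by (rule F)
  interpret P: module K "presented K S R" by (rule module_presented)
  interpret p: mod_hom K "free_vs K S" "presented K S R" proj by unfold_locales (rule proj_hom)
  obtain f where f: "f \<in> carrier (free_vs K S)" "x = proj f" using assms(1) proj_surj by auto
  have "P (proj f)" using cring_K f(1)
  proof (induction rule: free_vs_induct)
    case zero then show ?case using z by simp
  next
    case (step f a s)
    have b: "basis_vec K S s \<in> carrier (free_vs K S)" by (rule basis_vec_closed[OF F.R.ring_axioms])
    show ?case using st[OF p.f_im[OF step(1)] step(2,3,4)] step(1,2) b by (simp add: proj_basis)
  qed
  with f show ?thesis by simp
qed

lemma presented_hom_eq:
  assumes Q: "module K Q" and h: "h \<in> module_hom K (presented K S R) Q" and h': "h' \<in> module_hom K (presented K S R) Q"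
    and eq: "\<And>s. s \<in> S \<Longrightarrow> h (generator K S R s) = h' (generator K S R s)"
    and x: "x \<in> carrier (presented K S R)"
  shows "h x = h' x"
proof -
  interpret P: module K "presented K S R" by (rule module_presented)
  interpret Q: module K Q by fact
  interpret h: mod_hom K "presented K S R" Q h by unfold_locales (rule h)
  interpret h': mod_hom K "presented K S R" Q h' by unfold_locales (rule h')
  show ?thesis using x
    by (induction rule: presented_induct) (simp_all add: eq generator_closed)
qed

theorem presented_universal:
  assumes Q: "module K Q" and phi: "\<And>s. s \<in> S \<Longrightarrow> \<phi> s \<in> carrier Q"
    and rel: "\<And>u r. u \<in> module_hom K (free_vs K S) Q \<Longrightarrow> (\<And>s. s \<in> S \<Longrightarrow> u (basis_vec K S s) = \<phi> s) \<Longrightarrow>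
      r \<in> R \<Longrightarrow> u r = \<zero>\<^bsub>Q\<^esub>"
  shows "\<exists>!h. h \<in> module_hom K (presented K S R) Q \<inter> extensional (carrier (presented K S R)) \<and>
    (\<forall>s\<in>S. h (generator K S R s) = \<phi> s)"
proof -
  interpret F: module K "free_vs K S" by (rule F)
  interpret P: module K "presented K S R" by (rule module_presented)
  interpret Q: module K Q by fact
  obtain u where u: "u \<in> module_hom K (free_vs K S) Q" "\<And>s. s \<in> S \<Longrightarrow> u (basis_vec K S s) = \<phi> s"
    by (rule free_vs_lift[where S = S and \<phi> = \<phi>, OF Q phi]) (assumption, rule that)
  interpret u: mod_hom K "free_vs K S" Q u by unfold_locales (rule u)
  have "module.span K (free_vs K S) R \<subseteq> u.ker"
  proof (rule F.span_is_subset[OF _ u.ker_is_submodule], rule subsetI)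
    fix r assume "r \<in> R"
    then show "r \<in> u.ker" using rel[OF u] rels unfolding u.ker_def by blast
  qed
  then have uW: "u w = \<zero>\<^bsub>Q\<^esub>" if "w \<in> module.span K (free_vs K S) R" for w
    using that unfolding u.ker_def by blast
  obtain h where h: "h \<in> module_hom K (presented K S R) Q" and h2: "\<forall>x\<in>carrier (free_vs K S). h (proj x) = u x"
    using quot_lift[OF F span_sub Q u(1) uW, folded proj_def presented_def] by auto
  define h' where "h' = restrict h (carrier (presented K S R))"
  have h': "h' \<in> module_hom K (presented K S R) Q"
    using h P.a_closed P.smult_closed by (auto simp: module_hom_def h'_def)
  have g: "h' (generator K S R s) = \<phi> s" if "s \<in> S" for s
    using bspec[OF h2 basis_vec_closed[OF F.R.ring_axioms, of S s]] u(2)[OF that] generator_closed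
    by (simp add: h'_def proj_basis)
  show ?thesis
  proof (rule ex1I[of _ h'])
    show "h' \<in> module_hom K (presented K S R) Q \<inter> extensional (carrier (presented K S R)) \<and>
      (\<forall>s\<in>S. h' (generator K S R s) = \<phi> s)" using h' g by (simp add: h'_def)
    fix k assume k: "k \<in> module_hom K (presented K S R) Q \<inter> extensional (carrier (presented K S R)) \<and>
      (\<forall>s\<in>S. k (generator K S R s) = \<phi> s)"
    show "k = h'"
      by (rule extensionalityI[of _ "carrier (presented K S R)"])
        (use k g presented_hom_eq[OF Q _ h', of k] in \<open>auto simp: h'_def\<close>)
  qed
qed

end


subsection \<open>Tensor products and coends\<close>

lemma hom_neg_zero:
  assumes "module K V" "module K Q" "u \<in> module_hom K V Q" "x \<in> carrier V" "y \<in> carrier V" "u x = u y"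
  shows "u (x \<ominus>\<^bsub>V\<^esub> y) = \<zero>\<^bsub>Q\<^esub>"
proof -
  interpret Q: module K Q by fact
  interpret u: mod_hom K V Q u
    using assms by (simp add: mod_hom_def mod_hom_axioms_def)
  have "u (x \<ominus>\<^bsub>V\<^esub> y) = u y \<ominus>\<^bsub>Q\<^esub> u y" using u.f_minus[OF assms(4,5)] assms(6) by simp
  also have "\<dots> = \<zero>\<^bsub>Q\<^esub>" using Q.r_neg[OF u.f_im[OF assms(5)]] by (simp add: a_minus_def)
  finally show ?thesis .
qed

context presentation
begin

lemma basis_closed: "basis_vec K S s \<in> carrier (free_vs K S)"
  by (rule basis_vec_closed, rule cring.axioms(1)[OF cring_K])

lemma rel_eq:
  assumes r: "x \<ominus>\<^bsub>free_vs K S\<^esub> y \<in> R" and x: "x \<in> carrier (free_vs K S)" and y: "y \<in> carrier (free_vs K S)"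
  shows "proj x = proj y"
proof -
  interpret F: module K "free_vs K S" by (rule F)
  interpret P: module K "presented K S R" by (rule module_presented)
  have "x \<ominus>\<^bsub>free_vs K S\<^esub> y \<in> module.span K (free_vs K S) R" using r F.in_own_span[OF rels] by auto
  then show ?thesis unfolding proj_def using quot_eq[OF F span_sub x y] by simp
qed

lemma proj_add: "x \<in> carrier (free_vs K S) \<Longrightarrow> y \<in> carrier (free_vs K S) \<Longrightarrow>
    proj (x \<oplus>\<^bsub>free_vs K S\<^esub> y) = proj x \<oplus>\<^bsub>presented K S R\<^esub> proj y"
  using module_hom_add[OF proj_hom] .

lemma proj_smult: "a \<in> carrier K \<Longrightarrow> x \<in> carrier (free_vs K S) \<Longrightarrow>
    proj (a \<odot>\<^bsub>free_vs K S\<^esub> x) = a \<odot>\<^bsub>presented K S R\<^esub> proj x"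
  using module_hom_smult[OF proj_hom] .

lemma gen_add:
  assumes "basis_vec K S s \<ominus>\<^bsub>free_vs K S\<^esub> (basis_vec K S s1 \<oplus>\<^bsub>free_vs K S\<^esub> basis_vec K S s2) \<in> R"
  shows "generator K S R s = generator K S R s1 \<oplus>\<^bsub>presented K S R\<^esub> generator K S R s2"
proof -
  interpret F: module K "free_vs K S" by (rule F)
  show ?thesis using rel_eq[OF assms] by (simp add: basis_closed proj_add proj_basis)
qed

lemma gen_smult:
  assumes "basis_vec K S s \<ominus>\<^bsub>free_vs K S\<^esub> (a \<odot>\<^bsub>free_vs K S\<^esub> basis_vec K S s1) \<in> R" "a \<in> carrier K"
  shows "generator K S R s = a \<odot>\<^bsub>presented K S R\<^esub> generator K S R s1"
proof -
  interpret F: module K "free_vs K S" by (rule F)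
  show ?thesis using rel_eq[OF assms(1)] assms(2) by (simp add: basis_closed proj_smult proj_basis)
qed

lemma gen_eq:
  assumes "basis_vec K S s \<ominus>\<^bsub>free_vs K S\<^esub> basis_vec K S s1 \<in> R"
  shows "generator K S R s = generator K S R s1"
  using rel_eq[OF assms basis_closed basis_closed] by (simp add: proj_basis)

lemma gen_zero:
  assumes "basis_vec K S s \<in> R"
  shows "generator K S R s = \<zero>\<^bsub>presented K S R\<^esub>"
  using proj_rel[OF assms] by (simp add: proj_basis)

end


text \<open>Of the commutative monoid \<open>V\<close> only closure of the carrier under the operations is used.\<close>

locale cmon_tensor_context =
  fixes K :: "('k, 'c) ring_scheme" and V :: "('a, 'd) monoid_scheme" and P :: "('k, 'v, 'e) module_scheme"
  assumes P: "module K P" and V: "submonoid (carrier V) V"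
begin

lemma pres: "presentation K (carrier V \<times> carrier P) (cmon_tensor_rels K V P)"
proof -
  interpret P: module K P by (rule P)
  interpret F: module K "free_vs K (carrier V \<times> carrier P)" by (rule free_vs_module[OF P.R.cring_axioms])
  show ?thesis
    by (unfold_locales)
      (auto simp: cmon_tensor_rels_def Let_def basis_vec_closed[OF P.R.ring_axioms])
qed

sublocale presentation K "carrier V \<times> carrier P" "cmon_tensor_rels K V P" by (rule pres)

lemma mod: "module K (cmon_tensor K V P)"
  unfolding cmon_tensor_def by (rule module_presented)

lemma pure_closed: "cmon_pure K V P s \<in> carrier (cmon_tensor K V P)"
  unfolding cmon_tensor_def cmon_pure_def by (rule generator_closed)

lemma pure_add1: "v \<in> carrier V \<Longrightarrow> v' \<in> carrier V \<Longrightarrow> x \<in> carrier P \<Longrightarrow>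
  cmon_pure K V P (v \<otimes>\<^bsub>V\<^esub> v', x) = cmon_pure K V P (v, x) \<oplus>\<^bsub>cmon_tensor K V P\<^esub> cmon_pure K V P (v', x)"
  unfolding cmon_tensor_def cmon_pure_def
  by (rule gen_add) (unfold cmon_tensor_rels_def Let_def, blast)

lemma pure_zero1: "x \<in> carrier P \<Longrightarrow> cmon_pure K V P (\<one>\<^bsub>V\<^esub>, x) = \<zero>\<^bsub>cmon_tensor K V P\<^esub>"
  unfolding cmon_tensor_def cmon_pure_def
  by (rule gen_zero) (unfold cmon_tensor_rels_def Let_def, blast)

lemma pure_add2: "v \<in> carrier V \<Longrightarrow> x \<in> carrier P \<Longrightarrow> x' \<in> carrier P \<Longrightarrow>
  cmon_pure K V P (v, x \<oplus>\<^bsub>P\<^esub> x') = cmon_pure K V P (v, x) \<oplus>\<^bsub>cmon_tensor K V P\<^esub> cmon_pure K V P (v, x')"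
  unfolding cmon_tensor_def cmon_pure_def
  by (rule gen_add) (unfold cmon_tensor_rels_def Let_def, blast)

lemma pure_smult: "a \<in> carrier K \<Longrightarrow> v \<in> carrier V \<Longrightarrow> x \<in> carrier P \<Longrightarrow>
  cmon_pure K V P (v, a \<odot>\<^bsub>P\<^esub> x) = a \<odot>\<^bsub>cmon_tensor K V P\<^esub> cmon_pure K V P (v, x)"
  unfolding cmon_tensor_def cmon_pure_def
  by (rule gen_smult) (unfold cmon_tensor_rels_def Let_def, blast)

theorem universal:
  assumes Q: "module K Q" and phi: "\<And>v. v \<in> carrier V \<Longrightarrow> \<phi> v \<in> module_hom K P Q"
    and mult: "\<And>v v' x. v \<in> carrier V \<Longrightarrow> v' \<in> carrier V \<Longrightarrow> x \<in> carrier P \<Longrightarrow>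
      \<phi> (v \<otimes>\<^bsub>V\<^esub> v') x = \<phi> v x \<oplus>\<^bsub>Q\<^esub> \<phi> v' x"
    and one: "\<And>x. x \<in> carrier P \<Longrightarrow> \<phi> \<one>\<^bsub>V\<^esub> x = \<zero>\<^bsub>Q\<^esub>"
  shows "\<exists>!h. h \<in> module_hom K (cmon_tensor K V P) Q \<inter> extensional (carrier (cmon_tensor K V P)) \<and>
    (\<forall>v\<in>carrier V. \<forall>x\<in>carrier P. h (cmon_pure K V P (v, x)) = \<phi> v x)"
proof -
  interpret P: module K P by (rule P)
  interpret V: submonoid "carrier V" V by (rule V)
  interpret Q: module K Q by (rule Q)
  interpret F: module K "free_vs K (carrier V \<times> carrier P)" by (rule F)
  let ?phi = "\<lambda>(v, x). \<phi> v x"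
  have "\<exists>!h. h \<in> module_hom K (cmon_tensor K V P) Q \<inter> extensional (carrier (cmon_tensor K V P)) \<and>
    (\<forall>s\<in>carrier V \<times> carrier P. h (cmon_pure K V P s) = ?phi s)"
    unfolding cmon_tensor_def cmon_pure_def
  proof (rule presented_universal[OF Q])
    show "?phi s \<in> carrier Q" if "s \<in> carrier V \<times> carrier P" for s
      using that module_hom_closed[OF phi] by auto
    fix u r assume u: "u \<in> module_hom K (free_vs K (carrier V \<times> carrier P)) Q"
      and ub: "\<And>s. s \<in> carrier V \<times> carrier P \<Longrightarrow> u (basis_vec K (carrier V \<times> carrier P) s) = ?phi s"
      and r: "r \<in> cmon_tensor_rels K V P"
    interpret u: mod_hom K "free_vs K (carrier V \<times> carrier P)" Q u by unfold_locales (rule u)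
    note N = hom_neg_zero[OF F Q u] 
    show "u r = \<zero>\<^bsub>Q\<^esub>" using r unfolding cmon_tensor_rels_def Let_def
      by (auto intro!: N simp: basis_closed ub mult one module_hom_add[OF phi] module_hom_smult[OF phi])
  qed
  then show ?thesis by (simp add: split_paired_Ball_Sigma)
qed

lemma hom_eq:
  assumes "module K Q" "h \<in> module_hom K (cmon_tensor K V P) Q" "h' \<in> module_hom K (cmon_tensor K V P) Q"
    "\<And>v x. v \<in> carrier V \<Longrightarrow> x \<in> carrier P \<Longrightarrow> h (cmon_pure K V P (v, x)) = h' (cmon_pure K V P (v, x))"
    "w \<in> carrier (cmon_tensor K V P)"
  shows "h w = h' w"
  using presented_hom_eq[OF assms(1), of h h' w] assms unfolding cmon_tensor_def cmon_pure_def by auto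

end

lemma cmon_tensor_map_hom:
  assumes VP: "cmon_tensor_context K V P" and VP': "cmon_tensor_context K V' P'"
   and f: "\<And>v. v \<in> carrier V \<Longrightarrow> f v \<in> carrier V'"
    "\<And>v w. v \<in> carrier V \<Longrightarrow> w \<in> carrier V \<Longrightarrow> f (v \<otimes>\<^bsub>V\<^esub> w) = f v \<otimes>\<^bsub>V'\<^esub> f w"
    "f \<one>\<^bsub>V\<^esub> = \<one>\<^bsub>V'\<^esub>"
   and g: "g \<in> module_hom K P P'"
  shows "cmon_tensor_map K V P V' P' f g \<in> module_hom K (cmon_tensor K V P) (cmon_tensor K V' P')"
   and "\<And>v x. v \<in> carrier V \<Longrightarrow> x \<in> carrier P \<Longrightarrow>
      cmon_tensor_map K V P V' P' f g (cmon_pure K V P (v, x)) = cmon_pure K V' P' (f v, g x)"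
proof -
  interpret A: cmon_tensor_context K V P by fact
  interpret B: cmon_tensor_context K V' P' by fact
  have "\<exists>!h. h \<in> module_hom K (cmon_tensor K V P) (cmon_tensor K V' P') \<inter> extensional (carrier (cmon_tensor K V P)) \<and>
    (\<forall>v\<in>carrier V. \<forall>x\<in>carrier P. h (cmon_pure K V P (v, x)) = (\<lambda>v x. cmon_pure K V' P' (f v, g x)) v x)"
    by (rule A.universal[OF B.mod])
      (auto simp: module_hom_def[of K P] f B.pure_closed module_hom_add[OF g] module_hom_smult[OF g]
       funcset_mem[OF module_hom_closed[OF g]] B.pure_add1 B.pure_add2 B.pure_zero1 B.pure_smult)
  then have "\<exists>!h. h \<in> module_hom K (cmon_tensor K V P) (cmon_tensor K V' P') \<inter> extensional (carrier (cmon_tensor K V P)) \<and>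
    (\<forall>s\<in>carrier V \<times> carrier P. h (cmon_pure K V P s) = (\<lambda>(v, x). cmon_pure K V' P' (f v, g x)) s)"
    by (simp add: split_paired_Ball_Sigma)
  from theI'[OF this, folded linear_map_with_def cmon_tensor_map_def]
  show "cmon_tensor_map K V P V' P' f g \<in> module_hom K (cmon_tensor K V P) (cmon_tensor K V' P')"
   and "\<And>v x. v \<in> carrier V \<Longrightarrow> x \<in> carrier P \<Longrightarrow>
      cmon_tensor_map K V P V' P' f g (cmon_pure K V P (v, x)) = cmon_pure K V' P' (f v, g x)"
    by auto
qed


locale vs_tensor_context =
  fixes K :: "('k, 'c) ring_scheme" and P :: "('k, 'v, 'd) module_scheme" and P2 :: "('k, 'w, 'e) module_scheme"
  assumes P: "module K P" and P2: "module K P2"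
begin

lemma pres: "presentation K (carrier P \<times> carrier P2) (vs_tensor_rels K P P2)"
proof -
  interpret P: module K P by (rule P)
  interpret F: module K "free_vs K (carrier P \<times> carrier P2)" by (rule free_vs_module[OF P.R.cring_axioms])
  show ?thesis
    by (unfold_locales)
      (auto simp: vs_tensor_rels_def Let_def basis_vec_closed[OF P.R.ring_axioms])
qed

sublocale presentation K "carrier P \<times> carrier P2" "vs_tensor_rels K P P2" by (rule pres)

lemma mod: "module K (vs_tensor K P P2)"
  unfolding vs_tensor_def by (rule module_presented)

lemma pure_closed: "vs_pure K P P2 s \<in> carrier (vs_tensor K P P2)"
  unfolding vs_tensor_def vs_pure_def by (rule generator_closed)

lemma pure_add1: "x \<in> carrier P \<Longrightarrow> x' \<in> carrier P \<Longrightarrow> y \<in> carrier P2 \<Longrightarrow>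
  vs_pure K P P2 (x \<oplus>\<^bsub>P\<^esub> x', y) = vs_pure K P P2 (x, y) \<oplus>\<^bsub>vs_tensor K P P2\<^esub> vs_pure K P P2 (x', y)"
  unfolding vs_tensor_def vs_pure_def
  by (rule gen_add) (unfold vs_tensor_rels_def Let_def, blast)

lemma pure_add2: "x \<in> carrier P \<Longrightarrow> y \<in> carrier P2 \<Longrightarrow> y' \<in> carrier P2 \<Longrightarrow>
  vs_pure K P P2 (x, y \<oplus>\<^bsub>P2\<^esub> y') = vs_pure K P P2 (x, y) \<oplus>\<^bsub>vs_tensor K P P2\<^esub> vs_pure K P P2 (x, y')"
  unfolding vs_tensor_def vs_pure_def
  by (rule gen_add) (unfold vs_tensor_rels_def Let_def, blast)

lemma pure_smult1: "a \<in> carrier K \<Longrightarrow> x \<in> carrier P \<Longrightarrow> y \<in> carrier P2 \<Longrightarrow>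
  vs_pure K P P2 (a \<odot>\<^bsub>P\<^esub> x, y) = a \<odot>\<^bsub>vs_tensor K P P2\<^esub> vs_pure K P P2 (x, y)"
  unfolding vs_tensor_def vs_pure_def
  by (rule gen_smult) (unfold vs_tensor_rels_def Let_def, blast)

lemma pure_smult2: "a \<in> carrier K \<Longrightarrow> x \<in> carrier P \<Longrightarrow> y \<in> carrier P2 \<Longrightarrow>
  vs_pure K P P2 (x, a \<odot>\<^bsub>P2\<^esub> y) = a \<odot>\<^bsub>vs_tensor K P P2\<^esub> vs_pure K P P2 (x, y)"
  unfolding vs_tensor_def vs_pure_def
  by (rule gen_smult) (unfold vs_tensor_rels_def Let_def, blast)

theorem universal:
  assumes Q: "module K Q"
    and phi1: "\<And>x. x \<in> carrier P \<Longrightarrow> \<phi> x \<in> module_hom K P2 Q"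
    and phi2: "\<And>y. y \<in> carrier P2 \<Longrightarrow> (\<lambda>x. \<phi> x y) \<in> module_hom K P Q"
  shows "\<exists>!h. h \<in> module_hom K (vs_tensor K P P2) Q \<inter> extensional (carrier (vs_tensor K P P2)) \<and>
    (\<forall>x\<in>carrier P. \<forall>y\<in>carrier P2. h (vs_pure K P P2 (x, y)) = \<phi> x y)"
proof -
  interpret P: module K P by (rule P)
  interpret P2: module K P2 by (rule P2)
  interpret Q: module K Q by (rule Q)
  interpret F: module K "free_vs K (carrier P \<times> carrier P2)" by (rule F)
  let ?phi = "\<lambda>(x, y). \<phi> x y"
  have "\<exists>!h. h \<in> module_hom K (vs_tensor K P P2) Q \<inter> extensional (carrier (vs_tensor K P P2)) \<and>
    (\<forall>s\<in>carrier P \<times> carrier P2. h (vs_pure K P P2 s) = ?phi s)"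
    unfolding vs_tensor_def vs_pure_def
  proof (rule presented_universal[OF Q])
    show "?phi s \<in> carrier Q" if "s \<in> carrier P \<times> carrier P2" for s
      using that module_hom_closed[OF phi1] by auto
    fix u r assume u: "u \<in> module_hom K (free_vs K (carrier P \<times> carrier P2)) Q"
      and ub: "\<And>s. s \<in> carrier P \<times> carrier P2 \<Longrightarrow> u (basis_vec K (carrier P \<times> carrier P2) s) = ?phi s"
      and r: "r \<in> vs_tensor_rels K P P2"
    interpret u: mod_hom K "free_vs K (carrier P \<times> carrier P2)" Q u by unfold_locales (rule u)
    note N = hom_neg_zero[OF F Q u]
    show "u r = \<zero>\<^bsub>Q\<^esub>" using r unfolding vs_tensor_rels_def Let_def
      by (auto intro!: N simp: basis_closed ub module_hom_add[OF phi1] module_hom_smult[OF phi1]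
          module_hom_add[OF phi2] module_hom_smult[OF phi2])
  qed
  then show ?thesis by (simp add: split_paired_Ball_Sigma)
qed

lemma hom_eq:
  assumes "module K Q" "h \<in> module_hom K (vs_tensor K P P2) Q" "h' \<in> module_hom K (vs_tensor K P P2) Q"
    "\<And>v x. v \<in> carrier P \<Longrightarrow> x \<in> carrier P2 \<Longrightarrow> h (vs_pure K P P2 (v, x)) = h' (vs_pure K P P2 (v, x))"
    "w \<in> carrier (vs_tensor K P P2)"
  shows "h w = h' w"
  using presented_hom_eq[OF assms(1), of h h' w] assms unfolding vs_tensor_def vs_pure_def by auto

end

lemma vs_tensor_map_hom:
  assumes PQ: "vs_tensor_context K P Q" and PQ': "vs_tensor_context K P' Q'"
   and f: "f \<in> module_hom K P P'" and g: "g \<in> module_hom K Q Q'"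
  shows "vs_tensor_map K P Q P' Q' f g \<in> module_hom K (vs_tensor K P Q) (vs_tensor K P' Q')"
   and "\<And>x y. x \<in> carrier P \<Longrightarrow> y \<in> carrier Q \<Longrightarrow>
      vs_tensor_map K P Q P' Q' f g (vs_pure K P Q (x, y)) = vs_pure K P' Q' (f x, g y)"
proof -
  interpret A: vs_tensor_context K P Q by fact
  interpret B: vs_tensor_context K P' Q' by fact
  have "\<exists>!h. h \<in> module_hom K (vs_tensor K P Q) (vs_tensor K P' Q') \<inter> extensional (carrier (vs_tensor K P Q)) \<and>
    (\<forall>x\<in>carrier P. \<forall>y\<in>carrier Q. h (vs_pure K P Q (x, y)) = (\<lambda>x y. vs_pure K P' Q' (f x, g y)) x y)"
    by (rule A.universal[OF B.mod])
      (auto simp: module_hom_def[of K Q "vs_tensor K P' Q'"] module_hom_def[of K P "vs_tensor K P' Q'"] B.pure_closed module_hom_add[OF g] module_hom_smult[OF g]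
       funcset_mem[OF module_hom_closed[OF g]] module_hom_add[OF f] module_hom_smult[OF f]
       funcset_mem[OF module_hom_closed[OF f]] B.pure_add1 B.pure_add2 B.pure_smult1 B.pure_smult2)
  then have "\<exists>!h. h \<in> module_hom K (vs_tensor K P Q) (vs_tensor K P' Q') \<inter> extensional (carrier (vs_tensor K P Q)) \<and>
    (\<forall>s\<in>carrier P \<times> carrier Q. h (vs_pure K P Q s) = (\<lambda>(x, y). vs_pure K P' Q' (f x, g y)) s)"
    by (simp add: split_paired_Ball_Sigma)
  from theI'[OF this, folded linear_map_with_def vs_tensor_map_def]
  show "vs_tensor_map K P Q P' Q' f g \<in> module_hom K (vs_tensor K P Q) (vs_tensor K P' Q')"
   and "\<And>x y. x \<in> carrier P \<Longrightarrow> y \<in> carrier Q \<Longrightarrow>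
      vs_tensor_map K P Q P' Q' f g (vs_pure K P Q (x, y)) = vs_pure K P' Q' (f x, g y)"
    by auto
qed


locale coend_context =
  fixes K :: "('k, 'c) ring_scheme" and C :: "('o, 'm, 'b) cat_scheme"
    and F0 :: "'o \<Rightarrow> 'o \<Rightarrow> ('k, 'v) module" and F1 :: "'m \<Rightarrow> 'm \<Rightarrow> 'v \<Rightarrow> 'v"
  assumes C: "category C" and K: "cring K"
    and F0: "\<And>X Y. X \<in> Obj C \<Longrightarrow> Y \<in> Obj C \<Longrightarrow> module K (F0 X Y)"
    and F1: "\<And>f g A B A' B'. g \<in> Hom C A A' \<Longrightarrow> f \<in> Hom C B B' \<Longrightarrow> F1 g f \<in> module_hom K (F0 A' B) (F0 A B')"
begin

abbreviation "CS \<equiv> coend_gens C F0"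

lemma pres: "presentation K CS (coend_rels K C F0 F1)"
proof -
  interpret cring K by (rule K)
  interpret F: module K "free_vs K CS" by (rule free_vs_module[OF K])
  show ?thesis
    by (unfold_locales)
      (auto simp: coend_rels_def Let_def basis_vec_closed[OF ring_axioms])
qed

sublocale presentation K CS "coend_rels K C F0 F1" by (rule pres)

lemma mod: "module K (coend K C F0 F1)"
  unfolding coend_def by (rule module_presented)

lemma in_closed: "coend_in K C F0 F1 s \<in> carrier (coend K C F0 F1)"
  unfolding coend_def coend_in_def by (rule generator_closed)

lemma in_add: "X \<in> Obj C \<Longrightarrow> x \<in> carrier (F0 X X) \<Longrightarrow> y \<in> carrier (F0 X X) \<Longrightarrow>
  coend_in K C F0 F1 (X, x \<oplus>\<^bsub>F0 X X\<^esub> y) = coend_in K C F0 F1 (X, x) \<oplus>\<^bsub>coend K C F0 F1\<^esub> coend_in K C F0 F1 (X, y)"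
  unfolding coend_def coend_in_def
  by (rule gen_add) (unfold coend_rels_def Let_def, blast)

lemma in_smult: "a \<in> carrier K \<Longrightarrow> X \<in> Obj C \<Longrightarrow> x \<in> carrier (F0 X X) \<Longrightarrow>
  coend_in K C F0 F1 (X, a \<odot>\<^bsub>F0 X X\<^esub> x) = a \<odot>\<^bsub>coend K C F0 F1\<^esub> coend_in K C F0 F1 (X, x)"
  unfolding coend_def coend_in_def
  by (rule gen_smult) (unfold coend_rels_def Let_def, blast)

lemma in_wedge: "f \<in> Arr C \<Longrightarrow> x \<in> carrier (F0 (Cod C f) (Dom C f)) \<Longrightarrow>
  coend_in K C F0 F1 (Dom C f, F1 f (Ide C (Dom C f)) x) = coend_in K C F0 F1 (Cod C f, F1 (Ide C (Cod C f)) f x)"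
  unfolding coend_in_def
  by (rule gen_eq) (unfold coend_rels_def Let_def, blast)

theorem universal:
  assumes Q: "module K Q"
    and lam: "\<And>X. X \<in> Obj C \<Longrightarrow> \<theta> X \<in> module_hom K (F0 X X) Q"
    and wedge: "\<And>f x. f \<in> Arr C \<Longrightarrow> x \<in> carrier (F0 (Cod C f) (Dom C f)) \<Longrightarrow>
      \<theta> (Dom C f) (F1 f (Ide C (Dom C f)) x) = \<theta> (Cod C f) (F1 (Ide C (Cod C f)) f x)"
  shows "\<exists>!h. h \<in> module_hom K (coend K C F0 F1) Q \<inter> extensional (carrier (coend K C F0 F1)) \<and>
    (\<forall>X\<in>Obj C. \<forall>x\<in>carrier (F0 X X). h (coend_in K C F0 F1 (X, x)) = \<theta> X x)"
proof -
  interpret C: category C by (rule C)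
  interpret Q: module K Q by (rule Q)
  interpret F: module K "free_vs K CS" by (rule F)
  let ?phi = "\<lambda>(x, y). \<theta> x y"
  have "\<exists>!h. h \<in> module_hom K (coend K C F0 F1) Q \<inter> extensional (carrier (coend K C F0 F1)) \<and>
    (\<forall>s\<in>CS. h (coend_in K C F0 F1 s) = ?phi s)"
    unfolding coend_def coend_in_def
  proof (rule presented_universal[OF Q])
    show "?phi s \<in> carrier Q" if "s \<in> CS" for s
      using that module_hom_closed[OF lam] by (auto simp: coend_gens_def)
    fix u r assume u: "u \<in> module_hom K (free_vs K CS) Q"
      and ub: "\<And>s. s \<in> CS \<Longrightarrow> u (basis_vec K CS s) = ?phi s"
      and r: "r \<in> coend_rels K C F0 F1"
    interpret u: mod_hom K "free_vs K CS" Q u by unfold_locales (rule u)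
    note N = hom_neg_zero[OF F Q u]
    have ub': "u (basis_vec K CS (X, x)) = \<theta> X x" if "X \<in> Obj C" "x \<in> carrier (F0 X X)" for X x
      using ub[of "(X, x)"] that by (simp add: coend_gens_def)
    from r consider (add) X x y where "X \<in> Obj C" "x \<in> carrier (F0 X X)" "y \<in> carrier (F0 X X)"
        "r = basis_vec K CS (X, x \<oplus>\<^bsub>F0 X X\<^esub> y) \<ominus>\<^bsub>free_vs K CS\<^esub> (basis_vec K CS (X, x) \<oplus>\<^bsub>free_vs K CS\<^esub> basis_vec K CS (X, y))"
      | (smult) a X x where "a \<in> carrier K" "X \<in> Obj C" "x \<in> carrier (F0 X X)"
        "r = basis_vec K CS (X, a \<odot>\<^bsub>F0 X X\<^esub> x) \<ominus>\<^bsub>free_vs K CS\<^esub> (a \<odot>\<^bsub>free_vs K CS\<^esub> basis_vec K CS (X, x))"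
      | (wedge) f x where "f \<in> Arr C" "x \<in> carrier (F0 (Cod C f) (Dom C f))"
        "r = basis_vec K CS (Dom C f, F1 f (Ide C (Dom C f)) x) \<ominus>\<^bsub>free_vs K CS\<^esub> basis_vec K CS (Cod C f, F1 (Ide C (Cod C f)) f x)"
      unfolding coend_rels_def Let_def by blast
    then show "u r = \<zero>\<^bsub>Q\<^esub>"
    proof cases
      case add
      interpret X: module K "F0 X X" by (rule F0) (use add in auto)
      show ?thesis unfolding add(4) using add
        by (intro N) (simp_all add: basis_closed ub' module_hom_add[OF lam])
    next
      case smult
      interpret X: module K "F0 X X" by (rule F0) (use smult in auto)
      show ?thesis unfolding smult(4) using smult
        by (intro N) (simp_all add: basis_closed ub' module_hom_smult[OF lam])
    next
      case w: wedge
      have D: "Dom C f \<in> Obj C" "Cod C f \<in> Obj C" using w C.Dom_Obj C.Cod_Obj by auto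
      have f: "f \<in> Hom C (Dom C f) (Cod C f)" using w by (simp add: Hom_def)
      have "F1 f (Ide C (Dom C f)) x \<in> carrier (F0 (Dom C f) (Dom C f))"
        using module_hom_closed[OF F1[OF f C.Ide_Hom[OF D(1)]]] w by auto
      moreover have "F1 (Ide C (Cod C f)) f x \<in> carrier (F0 (Cod C f) (Cod C f))"
        using module_hom_closed[OF F1[OF C.Ide_Hom[OF D(2)] f]] w by auto
      ultimately show ?thesis unfolding w(3) using w D
        by (intro N) (simp_all add: basis_closed ub' wedge)
    qed
  qed
  then show ?thesis by (simp add: coend_gens_def split_paired_Ball_Sigma)
qed

lemma hom_eq:
  assumes "module K Q" "h \<in> module_hom K (coend K C F0 F1) Q" "h' \<in> module_hom K (coend K C F0 F1) Q"
    "\<And>X x. X \<in> Obj C \<Longrightarrow> x \<in> carrier (F0 X X) \<Longrightarrow> h (coend_in K C F0 F1 (X, x)) = h' (coend_in K C F0 F1 (X, x))"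
    "w \<in> carrier (coend K C F0 F1)"
  shows "h w = h' w"
  using presented_hom_eq[OF assms(1), of h h' w] assms unfolding coend_def coend_in_def by (auto simp: coend_gens_def)

end


section \<open>The Day convolution of Mackey functors is a Mackey functor\<close>

subsection \<open>Bilinearity of composition\<close>

locale additive_category = category C for C (structure) +
  assumes direct_sums: "has_finite_direct_sums C"
begin

declare One_nat_def [simp del]

lemma HomD: "f \<in> Hom C X Y \<Longrightarrow> Dom C f = X \<and> Cod C f = Y \<and> X \<in> Obj C \<and> Y \<in> Obj C"
  using Dom_Obj Cod_Obj by (auto simp: Hom_def)

lemma zero_object_exists: "\<exists>Z. zero_object C Z"
proof -
  have "\<exists>S p q. is_direct_sum C {..<0::nat} A S p q" for A
    using direct_sums unfolding has_finite_direct_sums_def by blast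
  then obtain S p q where "is_direct_sum C {..<0::nat} (\<lambda>_. undefined) S p q" by blast
  then have "zero_object C S"
    by (simp add: is_direct_sum_def is_product_def is_coproduct_def zero_object_def)
  then show ?thesis by blast
qed

lemma zero_object_ex:
  assumes "zero_object C Z" "X \<in> Obj C"
  shows "\<exists>f. f \<in> Hom C X Z" "\<exists>f. f \<in> Hom C Z X"
  using assms unfolding zero_object_def by (simp_all add: ex1_implies_ex)

lemma zero_arr_eq:
  assumes Z: "zero_object C Z" and h: "h \<in> Hom C X Z" and g: "g \<in> Hom C Z Y"
  shows "zero_arr C X Y = g \<cdot> h"
  unfolding zero_arr_def
proof (rule the_equality)
  show "\<exists>Z g' h'. zero_object C Z \<and> h' \<in> Hom C X Z \<and> g' \<in> Hom C Z Y \<and> g \<cdot> h = g' \<cdot> h'"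
    using assms by blast
  fix f assume "\<exists>Z g h. zero_object C Z \<and> h \<in> Hom C X Z \<and> g \<in> Hom C Z Y \<and> f = g \<cdot> h"
  then obtain Z' g' h' where 1: "zero_object C Z'" "h' \<in> Hom C X Z'" "g' \<in> Hom C Z' Y" "f = g' \<cdot> h'" by blast
  have Zs: "Z \<in> Obj C" "Z' \<in> Obj C" using Z 1 by (auto simp: zero_object_def)
  have XY: "X \<in> Obj C" "Y \<in> Obj C" using HomD h g by blast+
  obtain k where k: "k \<in> Hom C Z Z'" using zero_object_ex(2)[OF Z Zs(2)] by blast
  have "\<exists>!f. f \<in> Hom C X Z'" using 1(1) XY unfolding zero_object_def by blast
  then have "k \<cdot> h = h'" using Comp_Hom[OF h k] 1(2) by blast
  moreover have "\<exists>!f. f \<in> Hom C Z Y" using Z XY unfolding zero_object_def by blast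
  then have "g' \<cdot> k = g" using Comp_Hom[OF k 1(3)] g by blast
  ultimately show "f = g \<cdot> h" using 1(4) Comp_assoc[OF h k 1(3)] by simp
qed

lemma zero_arr_factor:
  assumes "X \<in> Obj C" "Y \<in> Obj C"
  obtains Z g h where "zero_object C Z" "h \<in> Hom C X Z" "g \<in> Hom C Z Y" "zero_arr C X Y = g \<cdot> h"
proof -
  obtain Z where Z: "zero_object C Z" using zero_object_exists by blast
  obtain h where h: "h \<in> Hom C X Z" using zero_object_ex(1)[OF Z assms(1)] by blast
  obtain g where g: "g \<in> Hom C Z Y" using zero_object_ex(2)[OF Z assms(2)] by blast
  note hg = h g
  show ?thesis by (rule that[OF Z hg zero_arr_eq[OF Z hg]])
qed

lemma zero_arr_Hom: "X \<in> Obj C \<Longrightarrow> Y \<in> Obj C \<Longrightarrow> zero_arr C X Y \<in> Hom C X Y"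
  by (metis zero_arr_factor Comp_Hom)

lemma zero_arr_Comp:
  assumes "f \<in> Hom C X Y" "Z \<in> Obj C" shows "zero_arr C Y Z \<cdot> f = zero_arr C X Z"
proof -
  have Y: "Y \<in> Obj C" using HomD assms by blast
  obtain O' g h where 1: "zero_object C O'" "h \<in> Hom C Y O'" "g \<in> Hom C O' Z" "zero_arr C Y Z = g \<cdot> h"
    using zero_arr_factor[OF Y assms(2)] by blast
  then show ?thesis using zero_arr_eq[OF 1(1) Comp_Hom[OF assms(1) 1(2)] 1(3)] Comp_assoc[OF assms(1) 1(2,3)] by simp
qed

lemma Comp_zero_arr:
  assumes "f \<in> Hom C Y Z" "X \<in> Obj C" shows "f \<cdot> zero_arr C X Y = zero_arr C X Z"
proof -
  have Y: "Y \<in> Obj C" using HomD assms by blast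
  obtain O' g h where 1: "zero_object C O'" "h \<in> Hom C X O'" "g \<in> Hom C O' Y" "zero_arr C X Y = g \<cdot> h"
    using zero_arr_factor[OF assms(2) Y] by blast
  then show ?thesis using zero_arr_eq[OF 1(1) 1(2) Comp_Hom[OF 1(3) assms(1)]] Comp_assoc[OF 1(2,3) assms(1)] by simp
qed

definition ds2 where "ds2 Y S p q \<longleftrightarrow> is_direct_sum C {..<2::nat} (\<lambda>_. Y) S p q"

lemma all_less_2: "(\<forall>i\<in>{..<2::nat}. P i) \<longleftrightarrow> P 0 \<and> P 1"
  by (auto simp: less_2_cases_iff One_nat_def)

lemma ds2_exists: "Y \<in> Obj C \<Longrightarrow> \<exists>S p q. ds2 Y S p q"
  using direct_sums[unfolded has_finite_direct_sums_def, rule_format, of 2 "\<lambda>_. Y"] unfolding ds2_def by simp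

lemma ds2_iff: "ds2 Y S p q \<longleftrightarrow> Y \<in> Obj C \<and> is_product C {..<2::nat} (\<lambda>_. Y) S p \<and> is_coproduct C {..<2::nat} (\<lambda>_. Y) S q \<and>
   p 0 \<cdot> q 0 = Ide C Y \<and> p 1 \<cdot> q 1 = Ide C Y \<and> p 1 \<cdot> q 0 = zero_arr C Y Y \<and> p 0 \<cdot> q 1 = zero_arr C Y Y"
  unfolding ds2_def is_direct_sum_def all_less_2 by auto

lemma ds2D:
  assumes "ds2 Y S p q"
  shows "Y \<in> Obj C" "S \<in> Obj C" "p 0 \<in> Hom C S Y" "p 1 \<in> Hom C S Y" "q 0 \<in> Hom C Y S" "q 1 \<in> Hom C Y S"
   "p 0 \<cdot> q 0 = Ide C Y" "p 1 \<cdot> q 1 = Ide C Y" "p 1 \<cdot> q 0 = zero_arr C Y Y" "p 0 \<cdot> q 1 = zero_arr C Y Y"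
  using assms unfolding ds2_iff is_product_def is_coproduct_def all_less_2 by auto

lemma ds2_pair:
  assumes "ds2 Y S p q" "f \<in> Hom C X Y" "g \<in> Hom C X Y"
  shows "\<exists>u. u \<in> Hom C X S \<and> p 0 \<cdot> u = f \<and> p 1 \<cdot> u = g"
proof -
  have X: "X \<in> Obj C" using HomD assms by blast
  have "\<forall>f. f 0 \<in> Hom C X Y \<and> f 1 \<in> Hom C X Y \<longrightarrow> (\<exists>!h. h \<in> Hom C X S \<and> p 0 \<cdot> h = f 0 \<and> p 1 \<cdot> h = f (1::nat))"
    using assms(1) X unfolding ds2_iff is_product_def all_less_2 by blast
  from this[rule_format, of "\<lambda>i. if i = 0 then f else g"] assms show ?thesis by auto
qed

lemma ds2_pair_unique:
  assumes "ds2 Y S p q" "u \<in> Hom C X S" "v \<in> Hom C X S" "p 0 \<cdot> u = p 0 \<cdot> v" "p 1 \<cdot> u = p 1 \<cdot> v"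
  shows "u = v"
proof -
  have X: "X \<in> Obj C" using HomD assms by blast
  have "\<forall>f. f 0 \<in> Hom C X Y \<and> f 1 \<in> Hom C X Y \<longrightarrow> (\<exists>!h. h \<in> Hom C X S \<and> p 0 \<cdot> h = f 0 \<and> p 1 \<cdot> h = f (1::nat))"
    using assms(1) X unfolding ds2_iff is_product_def all_less_2 by blast
  from this[rule_format, of "\<lambda>i. p i \<cdot> u"] assms ds2D[OF assms(1)] Comp_Hom show ?thesis by metis
qed

lemma ds2_copair:
  assumes "ds2 Y S p q" "f \<in> Hom C Y X" "g \<in> Hom C Y X"
  shows "\<exists>u. u \<in> Hom C S X \<and> u \<cdot> q 0 = f \<and> u \<cdot> q 1 = g"
proof -
  have X: "X \<in> Obj C" using HomD assms by blast
  have "\<forall>f. f 0 \<in> Hom C Y X \<and> f 1 \<in> Hom C Y X \<longrightarrow> (\<exists>!h. h \<in> Hom C S X \<and> h \<cdot> q 0 = f 0 \<and> h \<cdot> q 1 = f (1::nat))"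
    using assms(1) X unfolding ds2_iff is_coproduct_def all_less_2 by blast
  from this[rule_format, of "\<lambda>i. if i = 0 then f else g"] assms show ?thesis by auto
qed

lemma ds2_copair_unique:
  assumes "ds2 Y S p q" "u \<in> Hom C S X" "v \<in> Hom C S X" "u \<cdot> q 0 = v \<cdot> q 0" "u \<cdot> q 1 = v \<cdot> q 1"
  shows "u = v"
proof -
  have X: "X \<in> Obj C" using HomD assms by blast
  have "\<forall>f. f 0 \<in> Hom C Y X \<and> f 1 \<in> Hom C Y X \<longrightarrow> (\<exists>!h. h \<in> Hom C S X \<and> h \<cdot> q 0 = f 0 \<and> h \<cdot> q 1 = f (1::nat))"
    using assms(1) X unfolding ds2_iff is_coproduct_def all_less_2 by blast
  from this[rule_format, of "\<lambda>i. u \<cdot> q i"] assms ds2D[OF assms(1)] Comp_Hom show ?thesis by metis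
qed

lemma fold_compat:
  assumes S: "ds2 Y S p q" and S': "ds2 W S' p' q'" and h: "h \<in> Hom C Y W"
    and u: "u \<in> Hom C X S" and u': "u' \<in> Hom C X S'"
    and uu: "p' 0 \<cdot> u' = h \<cdot> (p 0 \<cdot> u)" "p' 1 \<cdot> u' = h \<cdot> (p 1 \<cdot> u)"
    and d: "d \<in> Hom C S Y" "d \<cdot> q 0 = Ide C Y" "d \<cdot> q 1 = Ide C Y"
    and d': "d' \<in> Hom C S' W" "d' \<cdot> q' 0 = Ide C W" "d' \<cdot> q' 1 = Ide C W"
  shows "d' \<cdot> u' = h \<cdot> (d \<cdot> u)"
proof -
  note SD = ds2D[OF S] and SD' = ds2D[OF S']
  obtain k where k: "k \<in> Hom C S S'" "p' 0 \<cdot> k = h \<cdot> p 0" "p' 1 \<cdot> k = h \<cdot> p 1"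
    using ds2_pair[OF S' Comp_Hom[OF SD(3) h] Comp_Hom[OF SD(4) h]] by blast
  have "k \<cdot> u = u'"
    by (rule ds2_pair_unique[OF S' Comp_Hom[OF u k(1)] u'])
      (simp_all add: uu k Comp_assoc[OF u k(1) SD'(3), symmetric] Comp_assoc[OF u k(1) SD'(4), symmetric]
        Comp_assoc[OF u SD(3) h] Comp_assoc[OF u SD(4) h])
  moreover have kq0: "k \<cdot> q 0 = q' 0 \<cdot> h"
    by (rule ds2_pair_unique[OF S' Comp_Hom[OF SD(5) k(1)] Comp_Hom[OF h SD'(5)]])
      (simp_all add: k Comp_assoc[OF SD(5) k(1) SD'(3), symmetric] Comp_assoc[OF SD(5) k(1) SD'(4), symmetric]
        Comp_assoc[OF SD(5) SD(3) h] Comp_assoc[OF SD(5) SD(4) h] SD SD'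
        Comp_assoc[OF h SD'(5) SD'(3), symmetric] Comp_assoc[OF h SD'(5) SD'(4), symmetric]
        Comp_Ide[OF h] Ide_Comp[OF h] Comp_zero_arr[OF h] zero_arr_Comp[OF h])
  moreover have kq1: "k \<cdot> q 1 = q' 1 \<cdot> h"
    by (rule ds2_pair_unique[OF S' Comp_Hom[OF SD(6) k(1)] Comp_Hom[OF h SD'(6)]])
      (simp_all only: k Comp_assoc[OF SD(6) k(1) SD'(3), symmetric] Comp_assoc[OF SD(6) k(1) SD'(4), symmetric]
        Comp_assoc[OF SD(6) SD(3) h] Comp_assoc[OF SD(6) SD(4) h] SD SD'
        Comp_assoc[OF h SD'(6) SD'(3), symmetric] Comp_assoc[OF h SD'(6) SD'(4), symmetric]
        Comp_Ide[OF h] Ide_Comp[OF h] Comp_zero_arr[OF h] zero_arr_Comp[OF h])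
  have "d' \<cdot> k = h \<cdot> d"
  proof (rule ds2_copair_unique[OF S Comp_Hom[OF k(1) d'(1)] Comp_Hom[OF d(1) h]])
    show "d' \<cdot> k \<cdot> q 0 = h \<cdot> d \<cdot> q 0"
      using Comp_assoc[OF SD(5) k(1) d'(1)] Comp_assoc[OF SD(5) d(1) h] kq0 Comp_assoc[OF h SD'(5) d'(1)] d d'
        Comp_Ide[OF h] Ide_Comp[OF h] by simp
    show "d' \<cdot> k \<cdot> q 1 = h \<cdot> d \<cdot> q 1"
      using Comp_assoc[OF SD(6) k(1) d'(1)] Comp_assoc[OF SD(6) d(1) h] kq1 Comp_assoc[OF h SD'(6) d'(1)] d d'
        Comp_Ide[OF h] Ide_Comp[OF h] by simp
  qed
  ultimately show ?thesis
    using Comp_assoc[OF u k(1) d'(1)] Comp_assoc[OF u d(1) h] by simp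
qed

lemma add_arr_eq:
  assumes f: "f \<in> Hom C X Y" and g: "g \<in> Hom C X Y" and S: "ds2 Y S p q"
    and u: "u \<in> Hom C X S" "p 0 \<cdot> u = f" "p 1 \<cdot> u = g"
    and d: "d \<in> Hom C S Y" "d \<cdot> q 0 = Ide C Y" "d \<cdot> q 1 = Ide C Y"
  shows "add_arr C f g = d \<cdot> u"
proof -
  have DC: "Dom C f = X" "Cod C f = Y" "Y \<in> Obj C" using HomD[OF f] by auto
  have I: "Ide C Y \<in> Hom C Y Y" using Ide_Hom DC by blast
  have du: "d \<cdot> u \<in> Hom C X Y" using Comp_Hom u d by blast
  show ?thesis
    unfolding add_arr_def DC ds2_def[symmetric]
  proof (rule the_equality)
    show "\<exists>S p q u' d'. ds2 Y S p q \<and> u' \<in> Hom C X S \<and> p 0 \<cdot> u' = f \<and> p 1 \<cdot> u' = g \<and>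
      d' \<in> Hom C S Y \<and> d' \<cdot> q 0 = Ide C Y \<and> d' \<cdot> q 1 = Ide C Y \<and> d \<cdot> u = d' \<cdot> u'"
      using S u d by blast
    fix h assume "\<exists>S p q u d. ds2 Y S p q \<and> u \<in> Hom C X S \<and> p 0 \<cdot> u = f \<and> p 1 \<cdot> u = g \<and>
      d \<in> Hom C S Y \<and> d \<cdot> q 0 = Ide C Y \<and> d \<cdot> q 1 = Ide C Y \<and> h = d \<cdot> u"
    then obtain S' p' q' u' d' where *: "ds2 Y S' p' q'" "u' \<in> Hom C X S'" "p' 0 \<cdot> u' = f" "p' 1 \<cdot> u' = g"
      "d' \<in> Hom C S' Y" "d' \<cdot> q' 0 = Ide C Y" "d' \<cdot> q' 1 = Ide C Y" "h = d' \<cdot> u'" by blast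
    have "d' \<cdot> u' = Ide C Y \<cdot> (d \<cdot> u)"
      by (rule fold_compat[OF S *(1) I u(1) *(2)]) (simp_all add: * u d Ide_Comp[OF f] Ide_Comp[OF g])
    with *(8) du show "h = d \<cdot> u" by (simp add: Ide_Comp)
  qed
qed

lemma add_arr_obtain:
  assumes f: "f \<in> Hom C X Y" and g: "g \<in> Hom C X Y"
  obtains S p q u d where "ds2 Y S p q" "u \<in> Hom C X S" "p 0 \<cdot> u = f" "p 1 \<cdot> u = g"
    "d \<in> Hom C S Y" "d \<cdot> q 0 = Ide C Y" "d \<cdot> q 1 = Ide C Y" "add_arr C f g = d \<cdot> u"
proof -
  have Y: "Y \<in> Obj C" using HomD[OF f] by auto
  have I: "Ide C Y \<in> Hom C Y Y" using Ide_Hom Y by blast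
  obtain S p q where S: "ds2 Y S p q" using ds2_exists[OF Y] by blast
  obtain u where u: "u \<in> Hom C X S" "p 0 \<cdot> u = f" "p 1 \<cdot> u = g" using ds2_pair[OF S f g] by blast
  obtain d where d: "d \<in> Hom C S Y" "d \<cdot> q 0 = Ide C Y" "d \<cdot> q 1 = Ide C Y" using ds2_copair[OF S I I] by blast
  show ?thesis by (rule that[OF S u d add_arr_eq[OF f g S u d]])
qed

lemma add_arr_Hom: "f \<in> Hom C X Y \<Longrightarrow> g \<in> Hom C X Y \<Longrightarrow> add_arr C f g \<in> Hom C X Y"
  by (metis add_arr_obtain Comp_Hom)

lemma Comp_add_arr:
  assumes f: "f \<in> Hom C X Y" and g: "g \<in> Hom C X Y" and h: "h \<in> Hom C Y W"
  shows "h \<cdot> add_arr C f g = add_arr C (h \<cdot> f) (h \<cdot> g)"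
proof -
  from add_arr_obtain[OF f g] obtain S p q u d where *: "ds2 Y S p q" "u \<in> Hom C X S" "p 0 \<cdot> u = f" "p 1 \<cdot> u = g"
    "d \<in> Hom C S Y" "d \<cdot> q 0 = Ide C Y" "d \<cdot> q 1 = Ide C Y" "add_arr C f g = d \<cdot> u" .
  from add_arr_obtain[OF Comp_Hom[OF f h] Comp_Hom[OF g h]] obtain S' p' q' u' d' where
    **: "ds2 W S' p' q'" "u' \<in> Hom C X S'" "p' 0 \<cdot> u' = h \<cdot> f" "p' 1 \<cdot> u' = h \<cdot> g"
    "d' \<in> Hom C S' W" "d' \<cdot> q' 0 = Ide C W" "d' \<cdot> q' 1 = Ide C W" "add_arr C (h \<cdot> f) (h \<cdot> g) = d' \<cdot> u'" .
  show ?thesis unfolding *(8) **(8)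
    by (rule fold_compat[OF *(1) **(1) h *(2) **(2), symmetric]) (simp_all add: * **)
qed

lemma add_arr_Comp:
  assumes f: "f \<in> Hom C X Y" and g: "g \<in> Hom C X Y" and k: "k \<in> Hom C W X"
  shows "add_arr C f g \<cdot> k = add_arr C (f \<cdot> k) (g \<cdot> k)"
proof -
  from add_arr_obtain[OF f g] obtain S p q u d where *: "ds2 Y S p q" "u \<in> Hom C X S" "p 0 \<cdot> u = f" "p 1 \<cdot> u = g"
    "d \<in> Hom C S Y" "d \<cdot> q 0 = Ide C Y" "d \<cdot> q 1 = Ide C Y" "add_arr C f g = d \<cdot> u" .
  have "add_arr C (f \<cdot> k) (g \<cdot> k) = d \<cdot> (u \<cdot> k)"
    by (rule add_arr_eq[OF Comp_Hom[OF k f] Comp_Hom[OF k g] *(1) Comp_Hom[OF k *(2)] _ _ *(5,6,7)])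
      (use Comp_assoc[OF k *(2)] ds2D[OF *(1)] * in auto)
  then show ?thesis using *(8) Comp_assoc[OF k *(2,5)] by simp
qed

end


subsection \<open>Functoriality of the Day convolution\<close>

lemma Hom_prod: "fg \<in> Hom (prod_cat C D) XY XY' \<longleftrightarrow>
   fst fg \<in> Hom C (fst XY) (fst XY') \<and> snd fg \<in> Hom D (snd XY) (snd XY')"
  by (cases fg; cases XY; cases XY') (auto simp: Hom_def prod_cat_def)

lemma prod_category: assumes "category C" "category D" shows "category (prod_cat C D)"
proof -
  interpret C: category C by fact
  interpret D: category D by fact
  show ?thesis
    by (unfold_locales; (unfold Hom_prod)?)
      (auto simp: prod_cat_def C.Dom_Obj C.Cod_Obj D.Dom_Obj D.Cod_Obj C.Ide_Hom D.Ide_Hom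
         C.Comp_Hom D.Comp_Hom C.Comp_Ide D.Comp_Ide C.Ide_Comp D.Ide_Comp C.Comp_assoc D.Comp_assoc)
qed

locale day_convolution_context =
  T: symmetric_monoidal_category T + field K + M: mackey_functor K T M + N: mackey_functor K T N
  for K :: "('k, 'c) ring_scheme" and T :: "('o, 'm, 'b) sm_cat_scheme"
    and M :: "('o, 'm, 'k, 'v) vfunctor" and N :: "('o, 'm, 'k, 'w) vfunctor" +
  assumes ds: "has_finite_direct_sums T"
begin

sublocale T: additive_category T by unfold_locales (rule ds)

lemma modM: "X \<in> Obj T \<Longrightarrow> module K (fobj M X)" using M.fobj_vs by (simp add: vectorspace_def)
lemma modN: "X \<in> Obj T \<Longrightarrow> module K (fobj N X)" using N.fobj_vs by (simp add: vectorspace_def)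

lemma vst: "X \<in> Obj T \<Longrightarrow> Y \<in> Obj T \<Longrightarrow> vs_tensor_context K (fobj M X) (fobj N Y)"
  by (simp add: vs_tensor_context_def modM modN)

lemma hom_mon_sel [simp]:
  "carrier (hom_monoid T X Y) = Hom T X Y" "mult (hom_monoid T X Y) = add_arr T" "one (hom_monoid T X Y) = zero_arr T X Y"
  by (simp_all add: hom_monoid_def)


abbreviation "P X Y \<equiv> vs_tensor K (fobj M X) (fobj N Y)"
abbreviation "HM \<equiv> hom_monoid T"
abbreviation "tob \<equiv> tensor_obj T"

lemma hm_sub: "X \<in> Obj T \<Longrightarrow> Y \<in> Obj T \<Longrightarrow> submonoid (carrier (HM X Y)) (HM X Y)"
  by (unfold_locales) (auto simp: T.add_arr_Hom T.zero_arr_Hom)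

lemma modP: "X \<in> Obj T \<Longrightarrow> Y \<in> Obj T \<Longrightarrow> module K (P X Y)"
  by (rule vs_tensor_context.mod[OF vst])

lemma cml: "A \<in> Obj T \<Longrightarrow> Z \<in> Obj T \<Longrightarrow> X \<in> Obj T \<Longrightarrow> Y \<in> Obj T \<Longrightarrow>
   cmon_tensor_context K (HM A Z) (P X Y)"
  by (simp only: cmon_tensor_context_def modP hm_sub simp_thms)

abbreviation "F0 Z \<equiv> day_integrand_obj K T M N Z"
abbreviation "F1 Z \<equiv> day_integrand_arr K T M N Z"

lemma F0_eq: "F0 Z (X', Y') (X, Y) = cmon_tensor K (HM (tob X' Y') Z) (P X Y)"
  by (simp add: day_integrand_obj_def)

abbreviation "VM f g \<equiv> vs_tensor_map K (fobj M (Dom T f)) (fobj N (Dom T g)) (fobj M (Cod T f)) (fobj N (Cod T g)) (farr M f) (farr N g)"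

lemma VM_hom:
  assumes f: "f \<in> Hom T X X'" and g: "g \<in> Hom T Y Y'"
  shows "VM f g \<in> module_hom K (P X Y) (P X' Y')"
    and "\<And>x y. x \<in> carrier (fobj M X) \<Longrightarrow> y \<in> carrier (fobj N Y) \<Longrightarrow>
      VM f g (vs_pure K (fobj M X) (fobj N Y) (x, y)) = vs_pure K (fobj M X') (fobj N Y') (farr M f x, farr N g y)"
  using vs_tensor_map_hom[OF vst vst M.farr_hom[OF f] N.farr_hom[OF g]] T.HomD[OF f] T.HomD[OF g] by auto

lemma F1_hom:
  assumes f': "f' \<in> Hom T A A'" and g': "g' \<in> Hom T B B'" and f: "f \<in> Hom T X X'" and g: "g \<in> Hom T Y Y'"
   and Z: "Z \<in> Obj T"
  shows "F1 Z (f', g') (f, g) \<in> module_hom K (F0 Z (A', B') (X, Y)) (F0 Z (A, B) (X', Y'))"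
    and "\<And>t x. t \<in> Hom T (tob A' B') Z \<Longrightarrow> x \<in> carrier (P X Y) \<Longrightarrow>
      F1 Z (f', g') (f, g) (cmon_pure K (HM (tob A' B') Z) (P X Y) (t, x)) =
        cmon_pure K (HM (tob A B) Z) (P X' Y') (Comp T t (tensor_arr T f' g'), VM f g x)"
proof -
  note H = T.HomD[OF f'] T.HomD[OF g'] T.HomD[OF f] T.HomD[OF g]
  have fg: "tensor_arr T f' g' \<in> Hom T (tob A B) (tob A' B')" by (rule T.tensor_Hom[OF f' g'])
  have O: "tob A B \<in> Obj T" "tob A' B' \<in> Obj T" using H T.tensor_Obj by auto
  have *: "cmon_tensor_context K (HM (tob A' B') Z) (P X Y)" "cmon_tensor_context K (HM (tob A B) Z) (P X' Y')"
    using cml O Z H by auto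
  note C = cmon_tensor_map_hom[OF * _ _ _ VM_hom(1)[OF f g], of "\<lambda>t. Comp T t (tensor_arr T f' g')", simplified]
  show "F1 Z (f', g') (f, g) \<in> module_hom K (F0 Z (A', B') (X, Y)) (F0 Z (A, B) (X', Y'))"
    using C(1) H fg Z by (simp add: day_integrand_arr_def F0_eq T.Comp_Hom T.add_arr_Comp T.zero_arr_Comp)
  show "F1 Z (f', g') (f, g) (cmon_pure K (HM (tob A' B') Z) (P X Y) (t, x)) =
        cmon_pure K (HM (tob A B) Z) (P X' Y') (Comp T t (tensor_arr T f' g'), VM f g x)"
    if "t \<in> Hom T (tob A' B') Z" "x \<in> carrier (P X Y)" for t x
    using C(2)[of t x] that H fg Z by (simp add: day_integrand_arr_def F0_eq T.Comp_Hom T.add_arr_Comp T.zero_arr_Comp)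
qed

lemma cl: assumes Z: "Z \<in> Obj T" shows "coend_context K (prod_cat T T) (F0 Z) (F1 Z)"
proof (intro coend_context.intro)
  show "category (prod_cat T T)" by (rule prod_category) (rule T.category_axioms)+
  show "cring K" by (rule is_cring)
  show "module K (F0 Z X Y)" if "X \<in> Obj (prod_cat T T)" "Y \<in> Obj (prod_cat T T)" for X Y
    using that cmon_tensor_context.mod[OF cml] Z T.tensor_Obj by (cases X; cases Y) (auto simp: F0_eq prod_cat_def)
  show "F1 Z g f \<in> module_hom K (F0 Z A' B) (F0 Z A B')"
    if "g \<in> Hom (prod_cat T T) A A'" "f \<in> Hom (prod_cat T T) B B'" for f g A B A' B'
    using that F1_hom(1)[OF _ _ _ _ Z] by (cases f; cases g; cases A; cases B; cases A'; cases B') (simp add: Hom_prod)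
qed

abbreviation "D Z \<equiv> day_obj K T M N Z"
abbreviation "jn Z \<equiv> day_in K T M N Z"

lemma modD: "Z \<in> Obj T \<Longrightarrow> module K (D Z)"
  unfolding day_obj_def by (rule coend_context.mod[OF cl])

abbreviation "post h X Y \<equiv> cmon_tensor_map K (HM (tob X Y) (Dom T h)) (P X Y) (HM (tob X Y) (Cod T h)) (P X Y)
            (\<lambda>t. Comp T h t) (\<lambda>x. x)"

lemma post_hom:
  assumes h: "h \<in> Hom T Z Z'" and XY: "X \<in> Obj T" "Y \<in> Obj T"
  shows "post h X Y \<in> module_hom K (F0 Z (X, Y) (X, Y)) (F0 Z' (X, Y) (X, Y))"
    and "\<And>t x. t \<in> Hom T (tob X Y) Z \<Longrightarrow> x \<in> carrier (P X Y) \<Longrightarrow>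
      post h X Y (cmon_pure K (HM (tob X Y) Z) (P X Y) (t, x)) = cmon_pure K (HM (tob X Y) Z') (P X Y) (Comp T h t, x)"
proof -
  note H = T.HomD[OF h]
  have O: "tob X Y \<in> Obj T" using XY T.tensor_Obj by auto
  have *: "cmon_tensor_context K (HM (tob X Y) Z) (P X Y)" "cmon_tensor_context K (HM (tob X Y) Z') (P X Y)"
    using cml O H XY by auto
  have i: "(\<lambda>x. x) \<in> module_hom K (P X Y) (P X Y)" by (simp add: module_hom_def)
  note C = cmon_tensor_map_hom[OF * _ _ _ i, of "\<lambda>t. Comp T h t", simplified]
  show "post h X Y \<in> module_hom K (F0 Z (X, Y) (X, Y)) (F0 Z' (X, Y) (X, Y))"
    using C(1) H h O by (simp add: F0_eq T.Comp_Hom T.Comp_add_arr T.Comp_zero_arr)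
  show "post h X Y (cmon_pure K (HM (tob X Y) Z) (P X Y) (t, x)) = cmon_pure K (HM (tob X Y) Z') (P X Y) (Comp T h t, x)"
    if "t \<in> Hom T (tob X Y) Z" "x \<in> carrier (P X Y)" for t x
    using C(2)[of t x] that H h O by (simp add: T.Comp_Hom T.Comp_add_arr T.Comp_zero_arr)
qed

lemma comp_hom:
  assumes "f \<in> module_hom K A B" "g \<in> module_hom K B C"
  shows "(\<lambda>x. g (f x)) \<in> module_hom K A C"
  using assms by (auto simp: module_hom_def Pi_def)

lemma jn_hom:
  assumes Z: "Z \<in> Obj T" and XY: "X \<in> Obj T" "Y \<in> Obj T"
  shows "(\<lambda>w. jn Z ((X, Y), w)) \<in> module_hom K (F0 Z (X, Y) (X, Y)) (D Z)"
  using coend_context.in_closed[OF cl[OF Z]] coend_context.in_add[OF cl[OF Z]] coend_context.in_smult[OF cl[OF Z]] XY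
  unfolding module_hom_def day_in_def day_obj_def by (simp add: prod_cat_def)

lemma jn_wedge:
  assumes Z: "Z \<in> Obj T" and f: "f \<in> Hom T X X'" and g: "g \<in> Hom T Y Y'"
    and w: "w \<in> carrier (F0 Z (X', Y') (X, Y))"
  shows "jn Z ((X, Y), F1 Z (f, g) (Ide T X, Ide T Y) w) = jn Z ((X', Y'), F1 Z (Ide T X', Ide T Y') (f, g) w)"
  using coend_context.in_wedge[OF cl[OF Z], of "(f, g)" w] f g w T.HomD[OF f] T.HomD[OF g]
  unfolding day_in_def by (simp add: prod_cat_def Hom_def)

lemma day_arr_hom:
  assumes h: "h \<in> Hom T Z Z'"
  shows "day_arr K T M N h \<in> module_hom K (D Z) (D Z')"
    and "\<And>X Y w. X \<in> Obj T \<Longrightarrow> Y \<in> Obj T \<Longrightarrow> w \<in> carrier (F0 Z (X, Y) (X, Y)) \<Longrightarrow>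
      day_arr K T M N h (jn Z ((X, Y), w)) = jn Z' ((X, Y), post h X Y w)"
proof -
  note H = T.HomD[OF h]
  have Z: "Z \<in> Obj T" and Z': "Z' \<in> Obj T" using H by auto
  let ?th = "\<lambda>XY w. jn Z' (XY, post h (fst XY) (snd XY) w)"
  have ex: "\<exists>!k. k \<in> module_hom K (D Z) (D Z') \<inter> extensional (carrier (D Z)) \<and>
    (\<forall>X\<in>Obj (prod_cat T T). \<forall>x\<in>carrier (F0 Z X X). k (jn Z (X, x)) = ?th X x)"
    unfolding day_obj_def[of K T M N Z] day_in_def[of K T M N Z]
  proof (rule coend_context.universal[OF cl[OF Z] modD[OF Z']])
    fix XY assume "XY \<in> Obj (prod_cat T T)"
    then obtain X Y where XY: "XY = (X, Y)" "X \<in> Obj T" "Y \<in> Obj T" by (auto simp: prod_cat_def)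
    show "?th XY \<in> module_hom K (F0 Z XY XY) (D Z')" unfolding XY(1) fst_conv snd_conv
      by (rule comp_hom[OF post_hom(1)[OF h XY(2,3)] jn_hom[OF Z' XY(2,3)]])
  next
    fix fg w assume fg: "fg \<in> Arr (prod_cat T T)" and w: "w \<in> carrier (F0 Z (Cod (prod_cat T T) fg) (Dom (prod_cat T T) fg))"
    obtain f g X X' Y Y' where e: "fg = (f, g)" and f: "f \<in> Hom T X X'" and g: "g \<in> Hom T Y Y'"
      using fg by (cases fg) (auto simp: prod_cat_def Hom_def)
    note Hf = T.HomD[OF f] and Hg = T.HomD[OF g]
    have dc: "Dom (prod_cat T T) fg = (X, Y)" "Cod (prod_cat T T) fg = (X', Y')"
      "Ide (prod_cat T T) (X, Y) = (Ide T X, Ide T Y)" "Ide (prod_cat T T) (X', Y') = (Ide T X', Ide T Y')"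
      using e Hf Hg by (auto simp: prod_cat_def)
    have I: "Ide T X \<in> Hom T X X" "Ide T X' \<in> Hom T X' X'" "Ide T Y \<in> Hom T Y Y" "Ide T Y' \<in> Hom T Y' Y'"
      using Hf Hg T.Ide_Hom by auto
    have O: "tob X Y \<in> Obj T" "tob X' Y' \<in> Obj T" using Hf Hg T.tensor_Obj by auto
    have fgH: "tensor_arr T f g \<in> Hom T (tob X Y) (tob X' Y')" by (rule T.tensor_Hom[OF f g])
    note A = F1_hom[OF f g I(1,3) Z] F1_hom[OF I(2,4) f g Z]
     and A' = F1_hom[OF f g I(1,3) Z'] F1_hom[OF I(2,4) f g Z']
    have VMc: "VM f g x \<in> carrier (P X' Y')" if "x \<in> carrier (P X Y)" for x
      using module_hom_closed[OF VM_hom(1)[OF f g]] that by auto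
    have VIc: "VM (Ide T X) (Ide T Y) x \<in> carrier (P X Y)" if "x \<in> carrier (P X Y)" for x
      using module_hom_closed[OF VM_hom(1)[OF I(1,3)]] that by auto
    define ph where "ph = cmon_tensor_map K (HM (tob X' Y') Z) (P X Y) (HM (tob X' Y') Z') (P X Y) (\<lambda>t. Comp T h t) (\<lambda>x. x)"
    have c: "cmon_tensor_context K (HM (tob X' Y') Z) (P X Y)" "cmon_tensor_context K (HM (tob X' Y') Z') (P X Y)"
       "cmon_tensor_context K (HM (tob X Y) Z') (P X Y)" "cmon_tensor_context K (HM (tob X' Y') Z') (P X' Y')"
      using cml O Z Z' Hf Hg by auto
    have i: "(\<lambda>x. x) \<in> module_hom K (P X Y) (P X Y)" by (simp add: module_hom_def)
    have ph: "ph \<in> module_hom K (F0 Z (X', Y') (X, Y)) (F0 Z' (X', Y') (X, Y))"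
      and php: "\<And>t x. t \<in> Hom T (tob X' Y') Z \<Longrightarrow> x \<in> carrier (P X Y) \<Longrightarrow>
        ph (cmon_pure K (HM (tob X' Y') Z) (P X Y) (t, x)) = cmon_pure K (HM (tob X' Y') Z') (P X Y) (Comp T h t, x)"
      using cmon_tensor_map_hom[OF c(1,2) _ _ _ i, of "\<lambda>t. Comp T h t", simplified] h O
      by (simp_all add: ph_def F0_eq T.Comp_Hom T.Comp_add_arr T.Comp_zero_arr)
    have w': "w \<in> carrier (cmon_tensor K (HM (tob X' Y') Z) (P X Y))" using w dc by (simp add: F0_eq)
    have 1: "post h X Y (F1 Z (f, g) (Ide T X, Ide T Y) w) = F1 Z' (f, g) (Ide T X, Ide T Y) (ph w)"
    proof (rule cmon_tensor_context.hom_eq[OF c(1) cmon_tensor_context.mod[OF c(3)] _ _ _ w'])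
      show "(\<lambda>w. post h X Y (F1 Z (f, g) (Ide T X, Ide T Y) w)) \<in> module_hom K (cmon_tensor K (HM (tob X' Y') Z) (P X Y)) (cmon_tensor K (HM (tob X Y) Z') (P X Y))"
        using comp_hom[OF A(1) post_hom(1)[OF h]] Hf Hg by (simp add: F0_eq)
      show "(\<lambda>w. F1 Z' (f, g) (Ide T X, Ide T Y) (ph w)) \<in> module_hom K (cmon_tensor K (HM (tob X' Y') Z) (P X Y)) (cmon_tensor K (HM (tob X Y) Z') (P X Y))"
        using comp_hom[OF ph A'(1)] by (simp add: F0_eq)
    qed (use A(2) A'(2) php post_hom(2)[OF h] Hf Hg h fgH VIc in \<open>simp add: T.Comp_Hom T.Comp_assoc[OF fgH _ h]\<close>)
    have 2: "post h X' Y' (F1 Z (Ide T X', Ide T Y') (f, g) w) = F1 Z' (Ide T X', Ide T Y') (f, g) (ph w)"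
    proof (rule cmon_tensor_context.hom_eq[OF c(1) cmon_tensor_context.mod[OF c(4)] _ _ _ w'])
      show "(\<lambda>w. post h X' Y' (F1 Z (Ide T X', Ide T Y') (f, g) w)) \<in> module_hom K (cmon_tensor K (HM (tob X' Y') Z) (P X Y)) (cmon_tensor K (HM (tob X' Y') Z') (P X' Y'))"
        using comp_hom[OF A(3) post_hom(1)[OF h]] Hf Hg by (simp add: F0_eq)
      show "(\<lambda>w. F1 Z' (Ide T X', Ide T Y') (f, g) (ph w)) \<in> module_hom K (cmon_tensor K (HM (tob X' Y') Z) (P X Y)) (cmon_tensor K (HM (tob X' Y') Z') (P X' Y'))"
        using comp_hom[OF ph A'(3)] by (simp add: F0_eq)
    qed (use A(4) A'(4) php post_hom(2)[OF h] Hf Hg h O VMc in \<open>simp add: T.Comp_Hom T.tensor_Ide T.Ide_Hom T.Comp_Ide\<close>)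
    have phc: "ph w \<in> carrier (F0 Z' (X', Y') (X, Y))" using module_hom_closed[OF ph] w dc by auto
    show "?th (Dom (prod_cat T T) fg) (F1 Z fg (Ide (prod_cat T T) (Dom (prod_cat T T) fg)) w)
      = ?th (Cod (prod_cat T T) fg) (F1 Z (Ide (prod_cat T T) (Cod (prod_cat T T) fg)) fg w)"
      unfolding dc[unfolded e] e fst_conv snd_conv 1 2 by (rule jn_wedge[OF Z' f g phc])
  qed
  then have "\<exists>!k. k \<in> module_hom K (D Z) (D Z') \<inter> extensional (carrier (D Z)) \<and>
    (\<forall>s\<in>coend_gens (prod_cat T T) (F0 Z). k (jn Z s) = (\<lambda>((X, Y), w). jn Z' ((X, Y), post h X Y w)) s)"
    by (simp add: coend_gens_def split_paired_Ball_Sigma prod_cat_def)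
  from theI'[OF this] H
  show "day_arr K T M N h \<in> module_hom K (D Z) (D Z')"
    and "\<And>X Y w. X \<in> Obj T \<Longrightarrow> Y \<in> Obj T \<Longrightarrow> w \<in> carrier (F0 Z (X, Y) (X, Y)) \<Longrightarrow>
      day_arr K T M N h (jn Z ((X, Y), w)) = jn Z' ((X, Y), post h X Y w)"
    by (auto simp: day_arr_def linear_map_with_def coend_gens_def prod_cat_def)
qed

lemma D_hom_eq:
  assumes Z: "Z \<in> Obj T" and Q: "module K Q" and "k \<in> module_hom K (D Z) Q" "k' \<in> module_hom K (D Z) Q"
   and "\<And>X Y t x. X \<in> Obj T \<Longrightarrow> Y \<in> Obj T \<Longrightarrow> t \<in> Hom T (tob X Y) Z \<Longrightarrow> x \<in> carrier (P X Y) \<Longrightarrow>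
     k (jn Z ((X, Y), cmon_pure K (HM (tob X Y) Z) (P X Y) (t, x))) = k' (jn Z ((X, Y), cmon_pure K (HM (tob X Y) Z) (P X Y) (t, x)))"
   and d: "d \<in> carrier (D Z)"
  shows "k d = k' d"
proof (rule coend_context.hom_eq[OF cl[OF Z] Q, folded day_obj_def day_in_def])
  fix XY w assume "XY \<in> Obj (prod_cat T T)" and w: "w \<in> carrier (F0 Z XY XY)"
  then obtain X Y where XY: "XY = (X, Y)" "X \<in> Obj T" "Y \<in> Obj T" by (auto simp: prod_cat_def)
  have c: "cmon_tensor_context K (HM (tob X Y) Z) (P X Y)" using cml XY Z T.tensor_Obj by auto
  show "k (jn Z (XY, w)) = k' (jn Z (XY, w))" unfolding XY(1)
    by (rule cmon_tensor_context.hom_eq[OF c Q comp_hom[OF jn_hom[OF Z XY(2,3), unfolded F0_eq] assms(3)] comp_hom[OF jn_hom[OF Z XY(2,3), unfolded F0_eq] assms(4)]])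
      (use assms XY w in \<open>auto simp: F0_eq\<close>)
qed (use assms in auto)

lemma day_arr_pure:
  assumes h: "h \<in> Hom T Z Z'" and XY: "X \<in> Obj T" "Y \<in> Obj T" and t: "t \<in> Hom T (tob X Y) Z" and x: "x \<in> carrier (P X Y)"
  shows "day_arr K T M N h (jn Z ((X, Y), cmon_pure K (HM (tob X Y) Z) (P X Y) (t, x))) =
    jn Z' ((X, Y), cmon_pure K (HM (tob X Y) Z') (P X Y) (Comp T h t, x))"
proof -
  have Z: "Z \<in> Obj T" using T.HomD[OF h] by auto
  have c: "cmon_tensor_context K (HM (tob X Y) Z) (P X Y)" using cml XY Z T.tensor_Obj by auto
  show ?thesis
    using day_arr_hom(2)[OF h XY] post_hom(2)[OF h XY t x] cmon_tensor_context.pure_closed[OF c] by (simp add: F0_eq)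
qed

theorem day_mackey: "mackey_functor K T (day_convolution K T M N)"
  unfolding day_convolution_def
proof (rule mackey_functor.intro, unfold vfunctor.simps)
  show "vectorspace K (D X)" if "X \<in> Obj T" for X
    using modD[OF that] field_axioms by (simp add: vectorspace_def)
  show "day_arr K T M N f \<in> module_hom K (D X) (D Y)" if "f \<in> Hom T X Y" for f X Y
    by (rule day_arr_hom(1)[OF that])
  show "day_arr K T M N (Ide T X) x = x" if X: "X \<in> Obj T" and "x \<in> carrier (D X)" for X x
    by (rule D_hom_eq[OF X modD[OF X] day_arr_hom(1)[OF T.Ide_Hom[OF X]] _ _ that(2), of "\<lambda>x. x"])
      (simp_all add: day_arr_pure[OF T.Ide_Hom[OF X]] T.Ide_Comp, simp add: module_hom_def)
  show "day_arr K T M N (Comp T g f) x = day_arr K T M N g (day_arr K T M N f x)"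
    if f: "f \<in> Hom T X Y" and g: "g \<in> Hom T Y Z" and "x \<in> carrier (D X)" for f X Y g Z x
  proof -
    have O: "X \<in> Obj T" "Y \<in> Obj T" "Z \<in> Obj T" using T.HomD[OF f] T.HomD[OF g] by auto
    note gf = T.Comp_Hom[OF f g]
    show ?thesis
      by (rule D_hom_eq[OF O(1) modD[OF O(3)] day_arr_hom(1)[OF gf] comp_hom[OF day_arr_hom(1)[OF f] day_arr_hom(1)[OF g]] _ that(3)])
        (simp add: day_arr_pure[OF gf] day_arr_pure[OF f] day_arr_pure[OF g] T.Comp_Hom[OF _ f] T.Comp_assoc[OF _ f g])
  qed
  show "day_arr K T M N (add_arr T f g) x = day_arr K T M N f x \<oplus>\<^bsub>D Y\<^esub> day_arr K T M N g x"
    if f: "f \<in> Hom T X Y" and g: "g \<in> Hom T X Y" and "x \<in> carrier (D X)" for f X Y g x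
  proof -
    have O: "X \<in> Obj T" "Y \<in> Obj T" using T.HomD[OF f] by auto
    interpret DY: module K "D Y" by (rule modD[OF O(2)])
    note fg = T.add_arr_Hom[OF f g]
    note fh = day_arr_hom(1)[OF f] and gh = day_arr_hom(1)[OF g]
    have s: "(\<lambda>x. day_arr K T M N f x \<oplus>\<^bsub>D Y\<^esub> day_arr K T M N g x) \<in> module_hom K (D X) (D Y)"
      using funcset_mem[OF module_hom_closed[OF fh]] funcset_mem[OF module_hom_closed[OF gh]]
        module_hom_add[OF fh] module_hom_add[OF gh] module_hom_smult[OF fh] module_hom_smult[OF gh]
      unfolding module_hom_def by (auto simp: DY.smult_r_distr DY.a_ac)
    show ?thesis
    proof (rule D_hom_eq[OF O(1) modD[OF O(2)] day_arr_hom(1)[OF fg] s _ that(3)])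
      fix A B t x assume AB: "A \<in> Obj T" "B \<in> Obj T" and t: "t \<in> Hom T (tob A B) X" and x: "x \<in> carrier (P A B)"
      have c: "cmon_tensor_context K (HM (tob A B) Y) (P A B)" using cml AB O T.tensor_Obj by auto
      show "day_arr K T M N (add_arr T f g) (jn X ((A, B), cmon_pure K (HM (tob A B) X) (P A B) (t, x))) =
        day_arr K T M N f (jn X ((A, B), cmon_pure K (HM (tob A B) X) (P A B) (t, x))) \<oplus>\<^bsub>D Y\<^esub>
        day_arr K T M N g (jn X ((A, B), cmon_pure K (HM (tob A B) X) (P A B) (t, x)))"
        using cmon_tensor_context.pure_add1[OF c, of "Comp T f t" "Comp T g t" x] T.Comp_Hom[OF t f] T.Comp_Hom[OF t g] x
          module_hom_add[OF jn_hom[OF O(2) AB, unfolded F0_eq] cmon_tensor_context.pure_closed[OF c] cmon_tensor_context.pure_closed[OF c]]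
        by (simp add: day_arr_pure[OF fg AB t x] day_arr_pure[OF f AB t x] day_arr_pure[OF g AB t x] T.add_arr_Comp[OF f g t])
    qed
  qed
  show "day_arr K T M N (zero_arr T X Y) x = \<zero>\<^bsub>D Y\<^esub>"
    if O: "X \<in> Obj T" "Y \<in> Obj T" and "x \<in> carrier (D X)" for X Y x
  proof -
    interpret DY: module K "D Y" by (rule modD[OF O(2)])
    note z = T.zero_arr_Hom[OF O]
    have s: "(\<lambda>x. \<zero>\<^bsub>D Y\<^esub>) \<in> module_hom K (D X) (D Y)" by (simp add: module_hom_def)
    show ?thesis
    proof (rule D_hom_eq[OF O(1) modD[OF O(2)] day_arr_hom(1)[OF z] s _ that(3)])
      fix A B t x assume AB: "A \<in> Obj T" "B \<in> Obj T" and t: "t \<in> Hom T (tob A B) X" and x: "x \<in> carrier (P A B)"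
      have c: "cmon_tensor_context K (HM (tob A B) Y) (P A B)" using cml AB O T.tensor_Obj by auto
      interpret j: mod_hom K "cmon_tensor K (HM (tob A B) Y) (P A B)" "D Y" "\<lambda>w. jn Y ((A, B), w)"
        using cmon_tensor_context.mod[OF c] modD[OF O(2)] jn_hom[OF O(2) AB, unfolded F0_eq]
        by (simp add: mod_hom_def mod_hom_axioms_def)
      show "day_arr K T M N (zero_arr T X Y) (jn X ((A, B), cmon_pure K (HM (tob A B) X) (P A B) (t, x))) = \<zero>\<^bsub>D Y\<^esub>"
        using cmon_tensor_context.pure_zero1[OF c x] j.f0_is_0
        by (simp add: day_arr_pure[OF z AB t x] T.zero_arr_Comp[OF t O(2)])
    qed
  qed
qed

end

end

theory Submission
  imports Defs
begin

text \<open>Write \<open>[t, x, y]\<close> for the class of \<open>t \<otimes> x \<otimes> y\<close> in \<open>(M * N)(Z)\<close>. If \<open>X\<close> is a direct sum of objects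
  \<open>C\<^sub>i\<close> in \<open>\<C>\<close>, then \<open>id\<^sub>X = \<Sum>\<^sub>i a\<^sub>i b\<^sub>i\<close> with \<open>a\<^sub>i : C\<^sub>i \<rightarrow> X\<close>, so that \<open>M(X)\<close> is spanned by the elements
  \<open>M(a)(c)\<close> with \<open>a : C \<rightarrow> X\<close>, \<open>C \<in> \<C>\<close>, and likewise for \<open>N(Y)\<close>. The coend relation
  \<open>[t, M(a)(c), N(b)(d)] = [t (a \<otimes> b), c, d]\<close> therefore reduces a spanning set of \<open>(M * N)(Z)\<close> to the
  elements \<open>[t, c, d]\<close> with \<open>c \<in> M(C)\<close>, \<open>d \<in> N(C')\<close> and \<open>t : C \<otimes> C' \<rightarrow> Z\<close> for \<open>C, C' \<in> \<C>\<close>, and by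
  multilinearity \<open>c\<close> and \<open>d\<close> may be taken from finite spanning sets and \<open>t\<close> from a finite set of
  monoid generators.\<close>

section \<open>Linear maps, spans and finite sums\<close>

lemma module_hom_zero:
  assumes "module K V" "module K Q" "f \<in> module_hom K V Q"
  shows "f \<zero>\<^bsub>V\<^esub> = \<zero>\<^bsub>Q\<^esub>"
proof -
  interpret f: mod_hom K V Q f using assms by (simp add: mod_hom_def mod_hom_axioms_def)
  show ?thesis by (rule f.f0_is_0)
qed

text \<open>The vectors that \<open>f\<close> sends into \<open>W\<close> form a submodule; it
  contains \<open>A\<close>, hence its span.\<close>

lemma module_hom_span_subset:
  assumes V: "module K V" and Q: "module K Q" and f: "f \<in> module_hom K V Q"
    and W: "LinearCombinations.submodule K W Q" and A: "A \<subseteq> carrier V" and fA: "f ` A \<subseteq> W"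
  shows "f ` module.span K V A \<subseteq> W"
proof -
  interpret V: module K V by fact
  interpret W: LinearCombinations.submodule K W Q by fact
  have "LinearCombinations.submodule K {x \<in> carrier V. f x \<in> W} V"
    by (rule submodule.intro)
      (auto simp: V module_hom_add[OF f] module_hom_smult[OF f] module_hom_zero[OF V Q f])
  from V.span_is_subset[OF _ this, of A] show ?thesis using A fA by blast
qed

text \<open>A linear map can be tested on a spanning set; this form is applied to each vector
  argument of \<open>pure\<close> in turn.\<close>

lemma module_hom_all_submodule:
  assumes "module K V" "module K Q" "f \<in> module_hom K V Q" "LinearCombinations.submodule K W Q"
    and "A \<subseteq> carrier V" "module.span K V A = carrier V" "\<And>x. x \<in> A \<Longrightarrow> f x \<in> W" "x \<in> carrier V"
  shows "f x \<in> W"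
  using module_hom_span_subset[OF assms(1-5)] assms(6-8) by blast

lemma submodule_finsum_closed:
  assumes V: "module K V" and W: "LinearCombinations.submodule K W V" and f: "f \<in> A \<rightarrow> W"
  shows "finsum V f A \<in> W"
proof -
  interpret V: module K V by fact
  interpret W: LinearCombinations.submodule K W V by fact
  show ?thesis using f
  \<comment> \<open>Over an infinite index set the sum is zero by convention, so that case is as
    immediate as the empty one.\<close>
  proof (induction A rule: infinite_finite_induct)
    case (insert a A)
    then have "f \<in> A \<rightarrow> carrier V" "f a \<in> carrier V" using W.subset by auto
    with insert show ?case by (simp add: Pi_def)
  qed simp_all
qed

section \<open>Sums of arrows and the identity of a direct sum\<close>

lemma hom_monoid_simps:
  "carrier (hom_monoid C X Y) = Hom C X Y" "mult (hom_monoid C X Y) = add_arr C"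
  "one (hom_monoid C X Y) = zero_arr C X Y"
  by (simp_all add: hom_monoid_def)

context additive_category
begin

context
  assumes hom_cmon: "\<And>X Y. X \<in> Obj C \<Longrightarrow> Y \<in> Obj C \<Longrightarrow> comm_monoid (hom_monoid C X Y)"
begin

text \<open>\<open>finprod\<close> is the sum of arrows, hom monoids being written multiplicatively.
  Postcomposition preserves \<open>add_arr\<close> and \<open>zero_arr\<close>, hence such sums. The
  monoid laws assumed in this context come from hypothesis (ii) in the theorem.\<close>

lemma Comp_finprod:
  assumes h: "h \<in> Hom C Y W" and X: "X \<in> Obj C" and f: "f \<in> A \<rightarrow> Hom C X Y"
  shows "h \<cdot> finprod (hom_monoid C X Y) f A = finprod (hom_monoid C X W) (\<lambda>i. h \<cdot> f i) A"
proof -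
  interpret XY: comm_monoid "hom_monoid C X Y" using hom_cmon X HomD[OF h] by blast
  interpret XW: comm_monoid "hom_monoid C X W" using hom_cmon X HomD[OF h] by blast
  note [simp] = hom_monoid_simps
  show ?thesis using f
  proof (induction A rule: infinite_finite_induct)
    case (insert a A)
    then have fA: "f \<in> A \<rightarrow> Hom C X Y" "f a \<in> Hom C X Y" by auto
    have "finprod (hom_monoid C X Y) f A \<in> Hom C X Y" using XY.finprod_closed[of f A] fA by simp
    moreover have "(\<lambda>i. h \<cdot> f i) \<in> A \<rightarrow> Hom C X W" using fA h Comp_Hom by blast
    ultimately show ?case
      using insert fA XY.finprod_insert[of A a f] XW.finprod_insert[of A a "\<lambda>i. h \<cdot> f i"] h
      by (simp add: Comp_add_arr Comp_Hom)
  qed (simp_all add: Comp_zero_arr[OF h X])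
qed

text \<open>Both sides have composite \<open>p j\<close> with each projection \<open>p j\<close>, so
  they agree by uniqueness in the product.\<close>

lemma direct_sum_Ide:
  assumes ds: "is_direct_sum C I A S p q" and I: "finite I"
  shows "finprod (hom_monoid C S S) (\<lambda>i. q i \<cdot> p i) I = Ide C S"
proof -
  have S: "S \<in> Obj C" and p: "\<And>i. i \<in> I \<Longrightarrow> p i \<in> Hom C S (A i)"
    and q: "\<And>i. i \<in> I \<Longrightarrow> q i \<in> Hom C (A i) S" and A: "\<And>i. i \<in> I \<Longrightarrow> A i \<in> Obj C"
    and pq: "\<And>i j. i \<in> I \<Longrightarrow> j \<in> I \<Longrightarrow> p j \<cdot> q i = (if i = j then Ide C (A i) else zero_arr C (A i) (A j))"
    using ds unfolding is_direct_sum_def is_product_def is_coproduct_def by auto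
  let ?h = "finprod (hom_monoid C S S) (\<lambda>i. q i \<cdot> p i) I"
  interpret SS: comm_monoid "hom_monoid C S S" using hom_cmon S by blast
  have qp: "(\<lambda>i. q i \<cdot> p i) \<in> I \<rightarrow> Hom C S S" using Comp_Hom[OF p q] by blast
  have h: "?h \<in> Hom C S S"
    using SS.finprod_closed[of "\<lambda>i. q i \<cdot> p i" I] qp by (simp add: hom_monoid_simps)
  have "p j \<cdot> ?h = p j" if j: "j \<in> I" for j
  proof -
    interpret Sj: comm_monoid "hom_monoid C S (A j)" using hom_cmon S A[OF j] by blast
    \<comment> \<open>By the relations between \<open>p\<close> and \<open>q\<close> only the term
      \<open>i = j\<close> survives, so the sum collapses to \<open>p j\<close>.\<close>
    have "p j \<cdot> (q i \<cdot> p i) = (if j = i then p i else \<one>\<^bsub>hom_monoid C S (A j)\<^esub>)" if "i \<in> I" for i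
      using Comp_assoc[OF p[OF that] q[OF that] p[OF j]] pq[OF that j] Ide_Comp[OF p[OF that]]
        zero_arr_Comp[OF p[OF that] A[OF j]] by (auto simp: hom_monoid_simps)
    moreover have "p j \<in> carrier (hom_monoid C S (A j))" using p[OF j] by (simp add: hom_monoid_simps)
    ultimately have "p j \<cdot> ?h = finprod (hom_monoid C S (A j))
        (\<lambda>i. if j = i then p j else \<one>\<^bsub>hom_monoid C S (A j)\<^esub>) I"
      unfolding Comp_finprod[OF p[OF j] S qp] by (intro Sj.finprod_cong') auto
    then show ?thesis
      using Sj.finprod_singleton[OF j I, of "\<lambda>_. p j"] p[OF j] by (simp add: hom_monoid_simps)
  qed
  moreover have "\<exists>!h. h \<in> Hom C S S \<and> (\<forall>i\<in>I. p i \<cdot> h = p i)"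
    using ds S p unfolding is_direct_sum_def is_product_def by blast
  ultimately show ?thesis using h Ide_Hom[OF S] Comp_Ide[OF p] by blast
qed

end

end

section \<open>Mackey functors are generated by their values on \<open>\<C>\<close>\<close>

context mackey_functor
begin

context
  assumes add_cat: "additive_category T"
    and hom_cmon: "\<And>X Y. X \<in> Obj T \<Longrightarrow> Y \<in> Obj T \<Longrightarrow> comm_monoid (hom_monoid T X Y)"
begin

interpretation T: additive_category T by (rule add_cat)

lemma fobj_module: "X \<in> Obj T \<Longrightarrow> module K (fobj M X)"
  using fobj_vs by (simp add: vectorspace_def)

lemma farr_closed: "f \<in> Hom T X Y \<Longrightarrow> x \<in> carrier (fobj M X) \<Longrightarrow> farr M f x \<in> carrier (fobj M Y)"
  using module_hom_closed[OF farr_hom] by blast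

text \<open>Since \<open>M\<close> is additive, evaluation at \<open>x\<close> is a homomorphism
  from the hom monoid to the additive monoid of \<open>M(Y)\<close>.\<close>

lemma farr_finprod:
  assumes X: "X \<in> Obj T" and Y: "Y \<in> Obj T" and f: "f \<in> A \<rightarrow> Hom T X Y"
    and x: "x \<in> carrier (fobj M X)"
  shows "farr M (finprod (hom_monoid T X Y) f A) x = finsum (fobj M Y) (\<lambda>i. farr M (f i) x) A"
proof -
  interpret XY: comm_monoid "hom_monoid T X Y" by (rule hom_cmon[OF X Y])
  interpret Y: module K "fobj M Y" by (rule fobj_module[OF Y])
  show ?thesis using f
  proof (induction A rule: infinite_finite_induct)
    case (insert a A)
    then have fA: "f \<in> A \<rightarrow> Hom T X Y" "f a \<in> Hom T X Y" by auto
    have "finprod (hom_monoid T X Y) f A \<in> Hom T X Y"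
      using XY.finprod_closed[of f A] fA by (simp add: hom_monoid_simps)
    moreover have "(\<lambda>i. farr M (f i) x) \<in> A \<rightarrow> carrier (fobj M Y)" using fA x farr_closed by blast
    ultimately show ?case
      using insert fA XY.finprod_insert[of A a f] farr_add[OF fA(2) _ x] farr_closed[OF fA(2) x]
      by (simp add: hom_monoid_simps)
  qed (simp_all add: hom_monoid_simps farr_zero[OF X Y x])
qed

text \<open>Additivity turns the decomposition of the identity of \<open>S\<close> into
  \<open>z = \<Sum> M(q i)(M(p i) z)\<close>, whose summands come from objects of
  \<open>\<C>\<close>; the isomorphism with \<open>S\<close> carries this over to
  \<open>X\<close>.\<close>

lemma fobj_span:
  assumes ds: "is_direct_sum T {..<n::nat} A S p q" and A: "\<And>i. i < n \<Longrightarrow> A i \<in> \<C>"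
    and iso: "isomorphic T X S" and X: "X \<in> Obj T"
  defines "G \<equiv> {farr M a c | C a c. C \<in> \<C> \<and> a \<in> Hom T C X \<and> c \<in> carrier (fobj M C)}"
  shows "G \<subseteq> carrier (fobj M X)" and "module.span K (fobj M X) G = carrier (fobj M X)"
proof -
  interpret X: module K "fobj M X" by (rule fobj_module[OF X])
  show G: "G \<subseteq> carrier (fobj M X)" unfolding G_def using farr_closed by blast
  obtain f g where f: "f \<in> Hom T X S" and g: "g \<in> Hom T S X" and gf: "g \<cdot>\<^bsub>T\<^esub> f = Ide T X"
    using iso unfolding isomorphic_def iso_arr_def inverse_arrs_def by (auto simp: Hom_def)
  have S: "S \<in> Obj T" and p: "\<And>i. i < n \<Longrightarrow> p i \<in> Hom T S (A i)"
    and q: "\<And>i. i < n \<Longrightarrow> q i \<in> Hom T (A i) S"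
    using ds unfolding is_direct_sum_def is_product_def is_coproduct_def by auto
  interpret S: module K "fobj M S" by (rule fobj_module[OF S])
  \<comment> \<open>The counterpart of \<open>G\<close> for the direct sum \<open>S\<close>.
    Composing arrows with \<open>g\<close> shows that \<open>M(g)\<close> sends it into
    \<open>G\<close>.\<close>
  define GS where "GS = {farr M a c | C a c. C \<in> \<C> \<and> a \<in> Hom T C S \<and> c \<in> carrier (fobj M C)}"
  have GS: "GS \<subseteq> carrier (fobj M S)" unfolding GS_def using farr_closed by blast
  have "farr M g ` GS \<subseteq> G"
  proof safe
    fix z assume "z \<in> GS"
    then obtain C a c where 1: "C \<in> \<C>" "a \<in> Hom T C S" "c \<in> carrier (fobj M C)" "z = farr M a c"
      unfolding GS_def by blast
    then have "farr M g z = farr M (g \<cdot>\<^bsub>T\<^esub> a) c" using farr_Comp[OF 1(2) g 1(3)] by simp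
    with 1 T.Comp_Hom[OF 1(2) g] show "farr M g z \<in> G" unfolding G_def by blast
  qed
  then have gS: "farr M g ` S.span GS \<subseteq> X.span G"
    using module_hom_span_subset[OF S.module_axioms X.module_axioms farr_hom[OF g]
        X.span_is_submodule[OF G] GS] X.in_own_span[OF G] by blast
  have "x \<in> X.span G" if x: "x \<in> carrier (fobj M X)" for x
  proof -
    define z where "z = farr M f x"
    have z: "z \<in> carrier (fobj M S)" unfolding z_def by (rule farr_closed[OF f x])
    \<comment> \<open>This is \<open>M(q i)\<close> applied to a vector of \<open>M(A i)\<close>,
      hence an element of \<open>GS\<close>.\<close>
    have "farr M (q i \<cdot>\<^bsub>T\<^esub> p i) z \<in> S.span GS" if i: "i < n" for i
      using farr_Comp[OF p[OF i] q[OF i] z] q[OF i] A[OF i] farr_closed[OF p[OF i] z] S.in_own_span[OF GS]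
      unfolding GS_def by auto
    then have "finsum (fobj M S) (\<lambda>i. farr M (q i \<cdot>\<^bsub>T\<^esub> p i) z) {..<n} \<in> S.span GS"
      by (intro submodule_finsum_closed[OF S.module_axioms S.span_is_submodule[OF GS]]) auto
    moreover have "z = finsum (fobj M S) (\<lambda>i. farr M (q i \<cdot>\<^bsub>T\<^esub> p i) z) {..<n}"
      using farr_finprod[OF S S, of "\<lambda>i. q i \<cdot>\<^bsub>T\<^esub> p i" "{..<n}" z] T.Comp_Hom[OF p q] z
        T.direct_sum_Ide[OF hom_cmon ds] farr_Ide[OF S z] by (simp add: Pi_def)
    ultimately have "farr M g z \<in> X.span G" using gS by auto
    then show ?thesis using farr_Comp[OF f g x] gf farr_Ide[OF X x] by (simp add: z_def)
  qed
  then show "X.span G = carrier (fobj M X)" using X.span_is_subset2[OF G] by blast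
qed

end

end

section \<open>Pure elements of the Day convolution\<close>

context day_convolution_context
begin

text \<open>The class \<open>[t, x, y]\<close>: the image of
  \<open>t \<otimes> (x \<otimes> y)\<close> under the coend injection at
  \<open>(X, Y)\<close>.\<close>

definition pure :: "'o \<Rightarrow> 'o \<Rightarrow> 'o \<Rightarrow> 'm \<Rightarrow> 'v \<Rightarrow> 'w
    \<Rightarrow> (('o \<times> 'o) \<times> ('m \<times> ('v \<times> 'w \<Rightarrow> 'k) set \<Rightarrow> 'k) set \<Rightarrow> 'k) set" where
  "pure Z X Y t x y = jn Z ((X, Y), cmon_pure K (HM (tob X Y) Z) (P X Y) (t, vs_pure K (fobj M X) (fobj N Y) (x, y)))"

context
  fixes Z X Y
  assumes Z: "Z \<in> Obj T" and X: "X \<in> Obj T" and Y: "Y \<in> Obj T"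
begin

lemma cmt: "cmon_tensor_context K (HM (tob X Y) Z) (P X Y)"
  by (intro cml T.tensor_Obj X Y Z)

text \<open>Stated for an arbitrary \<open>w\<close>, not only a pure tensor, so that it gives
  linearity of \<open>pure\<close> in \<open>x\<close> and in \<open>y\<close> and also the
  reduction from \<open>P X Y\<close> to pure tensors.\<close>

lemma cmon_pure_hom:
  assumes "t \<in> Hom T (tob X Y) Z"
  shows "(\<lambda>w. jn Z ((X, Y), cmon_pure K (HM (tob X Y) Z) (P X Y) (t, w))) \<in> module_hom K (P X Y) (D Z)"
proof -
  interpret cmon_tensor_context K "HM (tob X Y) Z" "P X Y" by (rule cmt)
  have "(\<lambda>w. cmon_pure K (HM (tob X Y) Z) (P X Y) (t, w)) \<in>
      module_hom K (P X Y) (cmon_tensor K (HM (tob X Y) Z) (P X Y))"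
    using assms by (simp add: module_hom_def pure_closed pure_add2 pure_smult)
  from comp_hom[OF this jn_hom[OF Z X Y, unfolded F0_eq]] show ?thesis .
qed

lemma pure_hom1:
  assumes t: "t \<in> Hom T (tob X Y) Z" and y: "y \<in> carrier (fobj N Y)"
  shows "(\<lambda>x. pure Z X Y t x y) \<in> module_hom K (fobj M X) (D Z)"
proof -
  interpret v: vs_tensor_context K "fobj M X" "fobj N Y" by (rule vst[OF X Y])
  have "(\<lambda>x. vs_pure K (fobj M X) (fobj N Y) (x, y)) \<in> module_hom K (fobj M X) (P X Y)"
    using y by (simp add: module_hom_def v.pure_closed v.pure_add1 v.pure_smult1)
  from comp_hom[OF this cmon_pure_hom[OF t]] show ?thesis unfolding pure_def .
qed

lemma pure_hom2:
  assumes t: "t \<in> Hom T (tob X Y) Z" and x: "x \<in> carrier (fobj M X)"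
  shows "(\<lambda>y. pure Z X Y t x y) \<in> module_hom K (fobj N Y) (D Z)"
proof -
  interpret v: vs_tensor_context K "fobj M X" "fobj N Y" by (rule vst[OF X Y])
  have "(\<lambda>y. vs_pure K (fobj M X) (fobj N Y) (x, y)) \<in> module_hom K (fobj N Y) (P X Y)"
    using x by (simp add: module_hom_def v.pure_closed v.pure_add2 v.pure_smult2)
  from comp_hom[OF this cmon_pure_hom[OF t]] show ?thesis unfolding pure_def .
qed

lemma pure_closed:
  assumes "t \<in> Hom T (tob X Y) Z" "x \<in> carrier (fobj M X)" "y \<in> carrier (fobj N Y)"
  shows "pure Z X Y t x y \<in> carrier (D Z)"
  using module_hom_closed[OF pure_hom1] assms by blast

text \<open>True for every \<open>s\<close>: outside the product of the carriers
  \<open>basis_vec\<close> is the zero vector.\<close>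

lemma vs_pure_closed: "vs_pure K (fobj M X) (fobj N Y) s \<in> carrier (P X Y)"
  by (rule vs_tensor_context.pure_closed[OF vst[OF X Y]])

lemma pure_add_arr:
  assumes t: "t \<in> Hom T (tob X Y) Z" "t' \<in> Hom T (tob X Y) Z"
  shows "pure Z X Y (add_arr T t t') x y = pure Z X Y t x y \<oplus>\<^bsub>D Z\<^esub> pure Z X Y t' x y"
proof -
  interpret c: cmon_tensor_context K "HM (tob X Y) Z" "P X Y" by (rule cmt)
  show ?thesis
    using c.pure_add1[of t t' "vs_pure K (fobj M X) (fobj N Y) (x, y)"] t vs_pure_closed
      module_hom_add[OF jn_hom[OF Z X Y, unfolded F0_eq] c.pure_closed c.pure_closed]
    by (simp add: pure_def)
qed

lemma pure_zero_arr: "pure Z X Y (zero_arr T (tob X Y) Z) x y = \<zero>\<^bsub>D Z\<^esub>"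
proof -
  interpret c: cmon_tensor_context K "HM (tob X Y) Z" "P X Y" by (rule cmt)
  show ?thesis
    using c.pure_zero1[OF vs_pure_closed] module_hom_zero[OF c.mod modD[OF Z] jn_hom[OF Z X Y, unfolded F0_eq]]
    by (simp add: pure_def)
qed

text \<open>Membership in \<open>W\<close> extends from generators one argument at a time: first
  \<open>y\<close>, then \<open>x\<close>, by linearity, and finally \<open>t\<close>, by
  additivity.\<close>

lemma pure_mem_submodule:
  assumes W: "LinearCombinations.submodule K W (D Z)"
    and hm: "\<And>H. submonoid H (HM (tob X Y) Z) \<Longrightarrow> GT \<subseteq> H \<Longrightarrow> H = carrier (HM (tob X Y) Z)"
    and GT: "GT \<subseteq> Hom T (tob X Y) Z"
    and A: "A \<subseteq> carrier (fobj M X)" "module.span K (fobj M X) A = carrier (fobj M X)"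
    and B: "B \<subseteq> carrier (fobj N Y)" "module.span K (fobj N Y) B = carrier (fobj N Y)"
    and gens: "\<And>t x y. t \<in> GT \<Longrightarrow> x \<in> A \<Longrightarrow> y \<in> B \<Longrightarrow> pure Z X Y t x y \<in> W"
    and t: "t \<in> Hom T (tob X Y) Z" and x: "x \<in> carrier (fobj M X)" and y: "y \<in> carrier (fobj N Y)"
  shows "pure Z X Y t x y \<in> W"
proof -
  interpret W: LinearCombinations.submodule K W "D Z" by (rule W)
  have 1: "pure Z X Y t x y \<in> W" if "t \<in> GT" "x \<in> A" "y \<in> carrier (fobj N Y)" for t x y
    by (rule module_hom_all_submodule[OF modN[OF Y] modD[OF Z] pure_hom2 W B])
      (use that gens A GT in auto)
  have 2: "pure Z X Y t x y \<in> W" if "t \<in> GT" for t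
    by (rule module_hom_all_submodule[OF modM[OF X] modD[OF Z] pure_hom1 W A])
      (use that 1 x y GT in auto)
  \<comment> \<open>As \<open>W\<close> contains zero and is closed under addition, these arrows
    form a submonoid. It contains \<open>GT\<close>, so it is the whole hom monoid.\<close>
  let ?H = "{t \<in> Hom T (tob X Y) Z. pure Z X Y t x y \<in> W}"
  have "submonoid ?H (HM (tob X Y) Z)"
    by (rule submonoid.intro)
      (auto simp: T.add_arr_Hom T.zero_arr_Hom T.tensor_Obj X Y Z pure_add_arr pure_zero_arr)
  from hm[OF this] show ?thesis using 2 GT t by auto
qed

end

text \<open>The coend relation at \<open>(f, g)\<close>, with both legs computed: one precomposes
  \<open>t\<close> with \<open>f \<otimes> g\<close>, the other applies \<open>M(f)\<close> and
  \<open>N(g)\<close> to the vectors.\<close>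

lemma pure_wedge:
  assumes Z: "Z \<in> Obj T" and f: "f \<in> Hom T X X'" and g: "g \<in> Hom T Y Y'"
    and t: "t \<in> Hom T (tob X' Y') Z" and x: "x \<in> carrier (fobj M X)" and y: "y \<in> carrier (fobj N Y)"
  shows "pure Z X' Y' t (farr M f x) (farr N g y) = pure Z X Y (Comp T t (tensor_arr T f g)) x y"
proof -
  have O: "X \<in> Obj T" "X' \<in> Obj T" "Y \<in> Obj T" "Y' \<in> Obj T" using T.HomD[OF f] T.HomD[OF g] by auto
  note I = T.Ide_Hom[OF O(1)] T.Ide_Hom[OF O(2)] T.Ide_Hom[OF O(3)] T.Ide_Hom[OF O(4)]
  let ?v = "vs_pure K (fobj M X) (fobj N Y) (x, y)"
  have v: "?v \<in> carrier (P X Y)" by (rule vs_pure_closed[OF Z O(1,3)])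
  \<comment> \<open>A mixed element: the arrow starts at \<open>X' \<otimes> Y'\<close> while the
    vectors lie over \<open>X\<close> and \<open>Y\<close>, so both legs apply to it.\<close>
  let ?w = "cmon_pure K (HM (tob X' Y') Z) (P X Y) (t, ?v)"
  have w: "?w \<in> carrier (F0 Z (X', Y') (X, Y))"
    unfolding F0_eq by (rule cmon_tensor_context.pure_closed[OF cml]) (simp_all add: O Z T.tensor_Obj)
  have "F1 Z (f, g) (Ide T X, Ide T Y) ?w =
      cmon_pure K (HM (tob X Y) Z) (P X Y) (Comp T t (tensor_arr T f g), ?v)"
    using F1_hom(2)[OF f g I(1,3) Z t v] VM_hom(2)[OF I(1,3) x y]
      M.farr_Ide[OF O(1) x] N.farr_Ide[OF O(3) y] by simp
  moreover have "F1 Z (Ide T X', Ide T Y') (f, g) ?w =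
      cmon_pure K (HM (tob X' Y') Z) (P X' Y') (t, vs_pure K (fobj M X') (fobj N Y') (farr M f x, farr N g y))"
    using F1_hom(2)[OF I(2,4) f g Z t v] VM_hom(2)[OF f g x y] T.tensor_Ide[OF O(2,4)] T.Comp_Ide[OF t] by simp
  ultimately show ?thesis using jn_wedge[OF Z f g w] by (simp add: pure_def)
qed

text \<open>The projection to the quotient by \<open>W\<close> kills every pure element, so it is
  the zero map by the uniqueness of linear maps out of the coend; its kernel is
  \<open>W\<close>.\<close>

lemma carrier_subset_submodule:
  assumes Z: "Z \<in> Obj T" and W: "LinearCombinations.submodule K W (D Z)"
    and pure: "\<And>X Y t x y. X \<in> Obj T \<Longrightarrow> Y \<in> Obj T \<Longrightarrow> t \<in> Hom T (tob X Y) Z \<Longrightarrow>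
      x \<in> carrier (fobj M X) \<Longrightarrow> y \<in> carrier (fobj N Y) \<Longrightarrow> pure Z X Y t x y \<in> W"
  shows "carrier (D Z) \<subseteq> W"
proof
  interpret W: LinearCombinations.submodule K W "D Z" by (rule W)
  interpret DZ: module K "D Z" by (rule modD[OF Z])
  define Q where "Q = quot_vs K (D Z) W"
  define \<pi> where "\<pi> = a_r_coset (D Z) W"
  interpret Q: module K Q unfolding Q_def by (rule quot_module[OF DZ.module_axioms W])
  have \<pi>: "\<pi> \<in> module_hom K (D Z) Q" unfolding \<pi>_def Q_def by (rule quot_proj_hom[OF DZ.module_axioms W])
  have ker: "\<pi> d = \<zero>\<^bsub>Q\<^esub> \<longleftrightarrow> d \<in> W" if "d \<in> carrier (D Z)" for d
  proof -
    have "\<ominus>\<^bsub>D Z\<^esub> \<zero>\<^bsub>D Z\<^esub> = \<zero>\<^bsub>D Z\<^esub>" by (rule DZ.minus_equality) simp_all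
    then have "d \<ominus>\<^bsub>D Z\<^esub> \<zero>\<^bsub>D Z\<^esub> = d" unfolding DZ.minus_eq by (metis DZ.r_zero that)
    then show ?thesis using quot_eq[OF DZ.module_axioms W that DZ.zero_closed]
      by (simp only: \<pi>_def Q_def quot_zero[OF DZ.module_axioms W])
  qed
  \<comment> \<open>General in \<open>V\<close> because the zero map is needed on \<open>D Z\<close>
    and on \<open>P X Y\<close>, whose vectors have different types.\<close>
  have zero: "(\<lambda>_. \<zero>\<^bsub>Q\<^esub>) \<in> module_hom K V Q" for V :: "('k, 'x, 'y) module_scheme"
    by (simp add: module_hom_def)
  fix d assume d: "d \<in> carrier (D Z)"
  have "\<pi> d = \<zero>\<^bsub>Q\<^esub>"
  proof (rule D_hom_eq[OF Z Q.module_axioms \<pi> zero _ d])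
    fix X Y t w assume O: "X \<in> Obj T" "Y \<in> Obj T" and t: "t \<in> Hom T (tob X Y) Z" and w: "w \<in> carrier (P X Y)"
    show "\<pi> (jn Z ((X, Y), cmon_pure K (HM (tob X Y) Z) (P X Y) (t, w))) = \<zero>\<^bsub>Q\<^esub>"
      by (rule vs_tensor_context.hom_eq[OF vst[OF O] Q.module_axioms comp_hom[OF cmon_pure_hom[OF Z O t] \<pi>] zero _ w])
        (use pure[OF O t] pure_closed[OF Z O t] ker in \<open>simp add: pure_def\<close>)
  qed
  with ker d show "d \<in> W" by blast
qed

end

section \<open>Finite dimensionality of the tensor product\<close>

theorem proposition9p1:
  fixes K :: "('k, 'c) ring_scheme"
    and T :: "('o, 'm, 'b) sm_cat_scheme"
    and \<C> :: "'o set"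
    and M :: "('o, 'm, 'k, 'v) vfunctor"
    and N :: "('o, 'm, 'k, 'w) vfunctor"
  assumes "field K"
    and "symmetric_compact_closed_category T"
    and "has_finite_direct_sums T"
    and "finite \<C>" and "\<C> \<subseteq> Obj T"
    and "\<And>X. X \<in> Obj T \<Longrightarrow> \<exists>(n::nat) C S p q. (\<forall>i<n. C i \<in> \<C>) \<and>
           is_direct_sum T {..<n} C S p q \<and> isomorphic T X S"
    and "\<And>X Y. X \<in> Obj T \<Longrightarrow> Y \<in> Obj T \<Longrightarrow> fin_gen_comm_monoid (hom_monoid T X Y)"
    and "fin_dim_mackey_functor K T M"
    and "fin_dim_mackey_functor K T N"
  shows "fin_dim_mackey_functor K T (day_convolution K T M N)"
proof -
  interpret M: mackey_functor K T M using assms(8) by (simp add: fin_dim_mackey_functor_def)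
  interpret N: mackey_functor K T N using assms(9) by (simp add: fin_dim_mackey_functor_def)
  interpret day_convolution_context K T M N
    using assms(1,2,3) M.mackey_functor_axioms N.mackey_functor_axioms
    by (simp add: day_convolution_context_def day_convolution_context_axioms_def
        symmetric_compact_closed_category_def)
  have hom_cmon: "comm_monoid (HM X Y)" if "X \<in> Obj T" "Y \<in> Obj T" for X Y
    using assms(7)[OF that] by (simp add: fin_gen_comm_monoid_def)
  note add_cat = T.additive_category_axioms
  have "vectorspace.fin_dim K (D Z)" if Z: "Z \<in> Obj T" for Z
  proof -
    interpret DZ: vectorspace K "D Z" using modD[OF Z] by (simp add: vectorspace_def field_axioms)
    have "\<exists>A. finite A \<and> A \<subseteq> carrier (fobj M X) \<and> module.span K (fobj M X) A = carrier (fobj M X)"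
      if "X \<in> Obj T" for X
      using assms(8) that vectorspace.fin_dim_def[OF M.fobj_vs[OF that]]
      by (simp add: fin_dim_mackey_functor_def)
    then obtain A where A: "\<And>X. X \<in> Obj T \<Longrightarrow> finite (A X)" "\<And>X. X \<in> Obj T \<Longrightarrow> A X \<subseteq> carrier (fobj M X)"
      "\<And>X. X \<in> Obj T \<Longrightarrow> module.span K (fobj M X) (A X) = carrier (fobj M X)" by metis
    have "\<exists>B. finite B \<and> B \<subseteq> carrier (fobj N X) \<and> module.span K (fobj N X) B = carrier (fobj N X)"
      if "X \<in> Obj T" for X
      using assms(9) that vectorspace.fin_dim_def[OF N.fobj_vs[OF that]]
      by (simp add: fin_dim_mackey_functor_def)
    then obtain B where B: "\<And>X. X \<in> Obj T \<Longrightarrow> finite (B X)" "\<And>X. X \<in> Obj T \<Longrightarrow> B X \<subseteq> carrier (fobj N X)"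
      "\<And>X. X \<in> Obj T \<Longrightarrow> module.span K (fobj N X) (B X) = carrier (fobj N X)" by metis
    have "\<exists>E. finite E \<and> E \<subseteq> Hom T X Z \<and> (\<forall>H. submonoid H (HM X Z) \<and> E \<subseteq> H \<longrightarrow> H = carrier (HM X Z))"
      if "X \<in> Obj T" for X
      using assms(7)[OF that Z] by (simp add: fin_gen_comm_monoid_def)
    \<comment> \<open>\<open>E X\<close> is a finite generating set of the monoid
      \<open>T(X, Z)\<close>; it is used at \<open>X = C \<otimes> C'\<close>.\<close>
    then obtain E where E: "\<And>X. X \<in> Obj T \<Longrightarrow> finite (E X)" "\<And>X. X \<in> Obj T \<Longrightarrow> E X \<subseteq> Hom T X Z"
      "\<And>X H. X \<in> Obj T \<Longrightarrow> submonoid H (HM X Z) \<Longrightarrow> E X \<subseteq> H \<Longrightarrow> H = carrier (HM X Z)" by metis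
    \<comment> \<open>The candidate spanning set: \<open>[t, x, y]\<close> over pairs of objects of
      \<open>\<C>\<close>, with all three entries from the chosen finite sets.\<close>
    define G where "G = (\<Union>C\<in>\<C>. \<Union>C'\<in>\<C>. \<Union>t\<in>E (tob C C'). \<Union>x\<in>A C. pure Z C C' t x ` B C')"
    have O: "C \<in> Obj T" if "C \<in> \<C>" for C using assms(5) that by blast
    have "finite G" unfolding G_def
      by (intro finite_UN_I finite_imageI assms(4) E(1) A(1) B(1) T.tensor_Obj O)
    moreover have G: "G \<subseteq> carrier (D Z)"
    proof (unfold G_def, safe)
      fix C C' t x y assume C: "C \<in> \<C>" "C' \<in> \<C>" and "t \<in> E (tob C C')" "x \<in> A C" "y \<in> B C'"
      then show "pure Z C C' t x y \<in> carrier (D Z)"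
        using E(2)[OF T.tensor_Obj[OF O O]] A(2)[OF O] B(2)[OF O] by (intro pure_closed Z O) blast+
    qed
    moreover have "DZ.span G = carrier (D Z)"
    proof
      show "DZ.span G \<subseteq> carrier (D Z)" by (rule DZ.span_is_subset2[OF G])
      note W = DZ.span_is_submodule[OF G]
      \<comment> \<open>Both objects in \<open>\<C>\<close>: multilinearity suffices.\<close>
      have 1: "pure Z C C' t x y \<in> DZ.span G" if C: "C \<in> \<C>" "C' \<in> \<C>"
        and txy: "t \<in> Hom T (tob C C') Z" "x \<in> carrier (fobj M C)" "y \<in> carrier (fobj N C')" for C C' t x y
      proof -
        note CO = O[OF C(1)] O[OF C(2)]
        note TO = T.tensor_Obj[OF CO]
        show ?thesis
        proof (rule pure_mem_submodule[OF Z CO W E(3)[OF TO] E(2)[OF TO] A(2,3)[OF CO(1)] B(2,3)[OF CO(2)] _ txy])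
          fix t x y assume "t \<in> E (tob C C')" "x \<in> A C" "y \<in> B C'"
          with C have "pure Z C C' t x y \<in> G" unfolding G_def by blast
          then show "pure Z C C' t x y \<in> DZ.span G" using DZ.in_own_span[OF G] by blast
        qed
      qed
      \<comment> \<open>First object arbitrary: for \<open>x = M(a)(c)\<close> the coend relation at
        \<open>a\<close> and the identity of \<open>C'\<close> gives
        \<open>[t (a \<otimes> id), c, y]\<close>, which is covered by fact
        \<open>1\<close>.\<close>
      have 2: "pure Z X C' t x y \<in> DZ.span G" if X: "X \<in> Obj T" and C': "C' \<in> \<C>"
        and t: "t \<in> Hom T (tob X C') Z" and x: "x \<in> carrier (fobj M X)" and y: "y \<in> carrier (fobj N C')" for X C' t x y
      proof -
        obtain n :: nat and A' S p q where 3: "\<forall>i<n. A' i \<in> \<C>" "is_direct_sum T {..<n} A' S p q" "isomorphic T X S"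
          using assms(6)[OF X] by blast
        note sp = M.fobj_span[OF add_cat hom_cmon 3(2) _ 3(3) X, of \<C>, OF _ _ 3(1)[rule_format]]
        show ?thesis
        proof (rule module_hom_all_submodule[OF modM[OF X] modD[OF Z] pure_hom1[OF Z X O[OF C'] t y] W sp _ x])
          fix z assume "z \<in> {farr M a c |C a c. C \<in> \<C> \<and> a \<in> Hom T C X \<and> c \<in> carrier (fobj M C)}"
          then obtain C a c where c: "C \<in> \<C>" "a \<in> Hom T C X" "c \<in> carrier (fobj M C)" "z = farr M a c" by blast
          have I: "Ide T C' \<in> Hom T C' C'" by (rule T.Ide_Hom[OF O[OF C']])
          show "pure Z X C' t z y \<in> DZ.span G"
            using pure_wedge[OF Z c(2) I t c(3) y] N.farr_Ide[OF O[OF C'] y] c(4)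
              1[OF c(1) C' T.Comp_Hom[OF T.tensor_Hom[OF c(2) I] t] c(3) y] by simp
        qed
      qed
      show "carrier (D Z) \<subseteq> DZ.span G"
      proof (rule carrier_subset_submodule[OF Z W])
        \<comment> \<open>Both objects arbitrary: the same argument in the second variable, with
          \<open>N(Y)\<close> spanned from \<open>\<C>\<close>, reduces to fact
          \<open>2\<close>.\<close>
        fix X Y t x y assume X: "X \<in> Obj T" and Y: "Y \<in> Obj T" and t: "t \<in> Hom T (tob X Y) Z"
          and x: "x \<in> carrier (fobj M X)" and y: "y \<in> carrier (fobj N Y)"
        obtain n :: nat and A' S p q where 3: "\<forall>i<n. A' i \<in> \<C>" "is_direct_sum T {..<n} A' S p q" "isomorphic T Y S"
          using assms(6)[OF Y] by blast
        note sp = N.fobj_span[OF add_cat hom_cmon 3(2) _ 3(3) Y, of \<C>, OF _ _ 3(1)[rule_format]]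
        show "pure Z X Y t x y \<in> DZ.span G"
        proof (rule module_hom_all_submodule[OF modN[OF Y] modD[OF Z] pure_hom2[OF Z X Y t x] W sp _ y])
          fix z assume "z \<in> {farr N a c |C a c. C \<in> \<C> \<and> a \<in> Hom T C Y \<and> c \<in> carrier (fobj N C)}"
          then obtain C a c where c: "C \<in> \<C>" "a \<in> Hom T C Y" "c \<in> carrier (fobj N C)" "z = farr N a c" by blast
          have I: "Ide T X \<in> Hom T X X" by (rule T.Ide_Hom[OF X])
          show "pure Z X Y t x z \<in> DZ.span G"
            using pure_wedge[OF Z I c(2) t x c(3)] M.farr_Ide[OF X x] c(4)
              2[OF X c(1) T.Comp_Hom[OF T.tensor_Hom[OF I c(2)] t] x c(3)] by simp
        qed
      qed
    qed
    ultimately show ?thesis unfolding DZ.fin_dim_def by blast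
  qed
  then show ?thesis using day_mackey by (simp add: fin_dim_mackey_functor_def day_convolution_def)
qed

end
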